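(* Let $(R,\mathfrak{m})$ be a Noetherian local ring with completion $\hat R$, and let $A\subseteq B$ be Artinian $R$-modules. Then $A$ is basically empty in $B$ if and only if $(B/A)^\vee$ is basically full in $B^\vee$ as $\hat R$-modules.
   Context: Let $k=R/\mathfrak{m}$, $E=E_R(k)$, $(-)^\vee=\mathrm{Hom}_R(-,E)$. Artinian $R$-modules are naturally $\hat R$-modules and their duals are finitely generated $\hat R$-modules; $(B/A)^\vee$ is regarded as a submodule of $B^\vee$ via $B\twoheadrightarrow B/A$. Basically full: for modules $L\subseteq M$ over a (quasi)local ring with $L$ finitely generated, $L$ is basically full in $M$ if for every finitely generated module $N$ with $L\subsetneq N\subseteq M$, no minimal generating set of $L$ can be extended to a minimal generating set of $N$. Cogenerating sets: a cogenerating set of an $R$-module $X$ is a finite list of $R$-linear maps $g_1,\dots,g_t: X\to E$ with $\bigcap_i\ker g_i=0$; it is minimal if for every $j$, $\bigcap_{i\neq j}\ker g_i\neq 0$. Basically empty: for Artinian $R$-modules $A\subseteq B$, $A$ is basically empty in $B$ if for every proper submodule $C\subsetneq A$, no minimal cogenerating set of $B/A$ extends to a minimal cogenerating set of $B/C$ (maps $B/A\to E$ being regarded as maps $B/C\to E$ by composing with $B/C\twoheadrightarrow B/A$). *)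

theory Defs
  imports "HOL-Algebra.Algebra"
begin

section \<open>Local rings and their completion\<close>

definition local_ring :: "('a, 'r) ring_scheme \<Rightarrow> 'a set \<Rightarrow> bool" where
  "local_ring R m \<longleftrightarrow> cring R \<and> maximalideal m R \<and> (\<forall>n. maximalideal n R \<longrightarrow> n = m)"

abbreviation ideal_power :: "('a, 'r) ring_scheme \<Rightarrow> 'a set \<Rightarrow> nat \<Rightarrow> 'a set" where
  "ideal_power R I n \<equiv> I [^]\<^bsub>ideals_set R\<^esub> n"

text \<open>
  The \<open>m\<close>-adic completion is the inverse limit of the rings \<open>R / m\<^sup>n\<close>. An element is a sequence
  of cosets; the coset \<open>s (Suc n)\<close> of \<open>m\<^sup>n\<^sup>+\<^sup>1\<close> is sent to the coset \<open>s n\<close> of \<open>m\<^sup>n\<close> by the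
  transition map iff it is contained in it.
\<close>

definition completion :: "('a, 'r) ring_scheme \<Rightarrow> 'a set \<Rightarrow> (nat \<Rightarrow> 'a set) ring" where
  "completion R m =
    \<lparr>carrier = {s. (\<forall>n. s n \<in> carrier (R Quot ideal_power R m n)) \<and> (\<forall>n. s (Suc n) \<subseteq> s n)},
     monoid.mult = (\<lambda>s t n. s n \<otimes>\<^bsub>R Quot ideal_power R m n\<^esub> t n),
     one = (\<lambda>n. \<one>\<^bsub>R Quot ideal_power R m n\<^esub>),
     ring.zero = (\<lambda>n. \<zero>\<^bsub>R Quot ideal_power R m n\<^esub>),
     add = (\<lambda>s t n. s n \<oplus>\<^bsub>R Quot ideal_power R m n\<^esub> t n)\<rparr>"


section \<open>Modules\<close>

text \<open>
  The record type of modules extends that of rings. The fields \<open>mult\<close> and \<open>one\<close> play no role for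
  modules and are left unspecified in the modules constructed below.
\<close>

definition regular_module :: "('a, 'r) ring_scheme \<Rightarrow> ('a, 'a) module" where
  "regular_module R =
    \<lparr>carrier = carrier R, monoid.mult = undefined, one = undefined,
     ring.zero = \<zero>\<^bsub>R\<^esub>, add = add R, smult = monoid.mult R\<rparr>"

definition quot_module ::
    "('a, 'r) ring_scheme \<Rightarrow> ('a, 'b, 'y) module_scheme \<Rightarrow> 'b set \<Rightarrow> ('a, 'b set) module" where
  "quot_module R M A =
    \<lparr>carrier = a_rcosets\<^bsub>M\<^esub> A, monoid.mult = undefined, one = undefined,
     ring.zero = A, add = set_add M, smult = (\<lambda>r W. \<Union>x\<in>W. A +>\<^bsub>M\<^esub> (r \<odot>\<^bsub>M\<^esub> x))\<rparr>"

text \<open>Linear maps are taken extensional, so that a map is determined by its values on the carrier.\<close>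

definition lin_maps ::
    "('a, 'r) ring_scheme \<Rightarrow> ('a, 'b, 'y) module_scheme \<Rightarrow> ('a, 'e, 'z) module_scheme \<Rightarrow> ('b \<Rightarrow> 'e) set" where
  "lin_maps R M N = {f \<in> carrier M \<rightarrow>\<^sub>E carrier N.
     (\<forall>x\<in>carrier M. \<forall>y\<in>carrier M. f (x \<oplus>\<^bsub>M\<^esub> y) = f x \<oplus>\<^bsub>N\<^esub> f y) \<and>
     (\<forall>r\<in>carrier R. \<forall>x\<in>carrier M. f (r \<odot>\<^bsub>M\<^esub> x) = r \<odot>\<^bsub>N\<^esub> f x)}"

definition artinian_module :: "('a, 'r) ring_scheme \<Rightarrow> ('a, 'b, 'y) module_scheme \<Rightarrow> bool" where
  "artinian_module R M \<longleftrightarrow> module R M \<and>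
     (\<forall>H :: nat \<Rightarrow> 'b set. (\<forall>n. submodule (H n) R M) \<and> (\<forall>n. H (Suc n) \<subseteq> H n)
        \<longrightarrow> (\<exists>n. \<forall>k\<ge>n. H k = H n))"

definition gen_submodule ::
    "('a, 'r) ring_scheme \<Rightarrow> ('a, 'b, 'y) module_scheme \<Rightarrow> 'b set \<Rightarrow> 'b set" where
  "gen_submodule R M S = \<Inter>{H. submodule H R M \<and> S \<subseteq> H}"

definition finitely_generated ::
    "('a, 'r) ring_scheme \<Rightarrow> ('a, 'b, 'y) module_scheme \<Rightarrow> 'b set \<Rightarrow> bool" where
  "finitely_generated R M L \<longleftrightarrow> (\<exists>S\<subseteq>L. finite S \<and> gen_submodule R M S = L)"

definition minimal_generating_set ::
    "('a, 'r) ring_scheme \<Rightarrow> ('a, 'b, 'y) module_scheme \<Rightarrow> 'b set \<Rightarrow> 'b set \<Rightarrow> bool" where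
  "minimal_generating_set R M L S \<longleftrightarrow>
     S \<subseteq> L \<and> gen_submodule R M S = L \<and> (\<forall>T. T \<subset> S \<longrightarrow> gen_submodule R M T \<noteq> L)"

definition basically_full ::
    "('a, 'r) ring_scheme \<Rightarrow> ('a, 'b, 'y) module_scheme \<Rightarrow> 'b set \<Rightarrow> bool" where
  "basically_full R M L \<longleftrightarrow> submodule L R M \<and> finitely_generated R M L \<and>
     (\<forall>N. submodule N R M \<and> finitely_generated R M N \<and> L \<subset> N \<longrightarrow>
        \<not> (\<exists>S T. minimal_generating_set R M L S \<and> minimal_generating_set R M N T \<and> S \<subseteq> T))"


section \<open>Injective hulls and duals\<close>

text \<open>
  In higher-order logic the test modules in the definition of injectivity range over one carrier
  type \<open>'c\<close> at a time, which is made explicit as an argument. Taking for \<open>'c\<close> the carrier type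
  of \<open>R\<close> is enough to obtain injectivity with respect to all test modules of all types, by
  Baer's criterion, since the inclusions of ideals into \<open>R\<close> are among the test inclusions.
\<close>

definition injective_module ::
    "'c itself \<Rightarrow> ('a, 'r) ring_scheme \<Rightarrow> ('a, 'e, 'z) module_scheme \<Rightarrow> bool" where
  "injective_module T R E \<longleftrightarrow> module R E \<and>
     (\<forall>(Y :: ('a, 'c) module) W f.
        module R Y \<and> submodule W R Y \<and> f \<in> lin_maps R (Y\<lparr>carrier := W\<rparr>) E \<longrightarrow>
        (\<exists>g\<in>lin_maps R Y E. \<forall>x\<in>W. g x = f x))"

text \<open>\<open>E\<close> is an injective hull of \<open>K\<close>: an injective module that is an essential extension of a
  copy of \<open>K\<close>.\<close>

definition injective_hull ::
    "'c itself \<Rightarrow> ('a, 'r) ring_scheme \<Rightarrow> ('a, 'k, 'y) module_scheme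
      \<Rightarrow> ('a, 'e, 'z) module_scheme \<Rightarrow> bool" where
  "injective_hull T R K E \<longleftrightarrow> injective_module T R E \<and>
     (\<exists>i\<in>lin_maps R K E. inj_on i (carrier K) \<and>
        (\<forall>U. submodule U R E \<and> U \<inter> i ` carrier K = {\<zero>\<^bsub>E\<^esub>} \<longrightarrow> U = {\<zero>\<^bsub>E\<^esub>}))"

text \<open>
  The natural module structure over the completion of a module \<open>W\<close> in which every element is
  annihilated by a power of \<open>m\<close> (such as an Artinian module over a Noetherian local ring): if \<open>m\<^sup>n\<close>
  annihilates \<open>x\<close>, then \<open>s\<close> acts on \<open>x\<close> as any representative of its component in \<open>R / m\<^sup>n\<close>.
\<close>

definition completed_module ::
    "('a, 'r) ring_scheme \<Rightarrow> 'a set \<Rightarrow> ('a, 'b, 'y) module_scheme \<Rightarrow> (nat \<Rightarrow> 'a set, 'b) module" where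
  "completed_module R m W =
    \<lparr>carrier = carrier W, monoid.mult = undefined, one = undefined, ring.zero = \<zero>\<^bsub>W\<^esub>, add = add W,
     smult = (\<lambda>s x. THE y. \<exists>n r. (\<forall>a\<in>ideal_power R m n. a \<odot>\<^bsub>W\<^esub> x = \<zero>\<^bsub>W\<^esub>) \<and>
                r \<in> s n \<and> y = r \<odot>\<^bsub>W\<^esub> x)\<rparr>"

text \<open>\<open>Hom\<^sub>R(W, E)\<close> as a module over the completion, for \<open>W\<close> Artinian; the scalars act
  through \<open>W\<close>.\<close>

definition dual_module ::
    "('a, 'r) ring_scheme \<Rightarrow> 'a set \<Rightarrow> ('a, 'e, 'z) module_scheme \<Rightarrow> ('a, 'b, 'y) module_scheme
      \<Rightarrow> (nat \<Rightarrow> 'a set, 'b \<Rightarrow> 'e) module" where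
  "dual_module R m E W =
    \<lparr>carrier = lin_maps R W E, monoid.mult = undefined, one = undefined,
     ring.zero = (\<lambda>x\<in>carrier W. \<zero>\<^bsub>E\<^esub>),
     add = (\<lambda>f g. \<lambda>x\<in>carrier W. f x \<oplus>\<^bsub>E\<^esub> g x),
     smult = (\<lambda>s f. \<lambda>x\<in>carrier W. f (s \<odot>\<^bsub>completed_module R m W\<^esub> x))\<rparr>"

text \<open>The image of \<open>(B/A)\<^sup>\<or>\<close> in \<open>B\<^sup>\<or>\<close> under composition with the projection \<open>B \<rightarrow> B/A\<close>.\<close>

definition dual_of_quotient ::
    "('a, 'r) ring_scheme \<Rightarrow> 'a set \<Rightarrow> ('a, 'e, 'z) module_scheme \<Rightarrow> ('a, 'b, 'y) module_scheme
      \<Rightarrow> 'b set \<Rightarrow> ('b \<Rightarrow> 'e) set" where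
  "dual_of_quotient R m E B A =
     (\<lambda>g. \<lambda>x\<in>carrier B. g (A +>\<^bsub>B\<^esub> x)) ` carrier (dual_module R m E (quot_module R B A))"


section \<open>Cogenerating sets\<close>

definition cogenerating_set ::
    "('a, 'r) ring_scheme \<Rightarrow> ('a, 'e, 'z) module_scheme \<Rightarrow> ('a, 'b, 'y) module_scheme
      \<Rightarrow> ('b \<Rightarrow> 'e) list \<Rightarrow> bool" where
  "cogenerating_set R E W gs \<longleftrightarrow> set gs \<subseteq> lin_maps R W E \<and>
     {x\<in>carrier W. \<forall>i<length gs. (gs ! i) x = \<zero>\<^bsub>E\<^esub>} = {\<zero>\<^bsub>W\<^esub>}"

definition minimal_cogenerating_set ::
    "('a, 'r) ring_scheme \<Rightarrow> ('a, 'e, 'z) module_scheme \<Rightarrow> ('a, 'b, 'y) module_scheme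
      \<Rightarrow> ('b \<Rightarrow> 'e) list \<Rightarrow> bool" where
  "minimal_cogenerating_set R E W gs \<longleftrightarrow> cogenerating_set R E W gs \<and>
     (\<forall>j<length gs. {x\<in>carrier W. \<forall>i<length gs. i \<noteq> j \<longrightarrow> (gs ! i) x = \<zero>\<^bsub>E\<^esub>} \<noteq> {\<zero>\<^bsub>W\<^esub>})"

text \<open>For \<open>C \<subseteq> A \<subseteq> B\<close>, the composite of \<open>B/C \<rightarrow> B/A\<close> with a map \<open>g\<close> on \<open>B/A\<close>; the projection
  sends a coset \<open>W\<close> of \<open>C\<close> to the coset \<open>A + W\<close> of \<open>A\<close>.\<close>

definition pull_back ::
    "('a, 'r) ring_scheme \<Rightarrow> ('a, 'b, 'y) module_scheme \<Rightarrow> 'b set \<Rightarrow> 'b set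
      \<Rightarrow> ('b set \<Rightarrow> 'e) \<Rightarrow> 'b set \<Rightarrow> 'e" where
  "pull_back R B C A g = (\<lambda>W\<in>carrier (quot_module R B C). g (A <+>\<^bsub>B\<^esub> W))"

definition basically_empty ::
    "('a, 'r) ring_scheme \<Rightarrow> ('a, 'e, 'z) module_scheme \<Rightarrow> ('a, 'b, 'y) module_scheme
      \<Rightarrow> 'b set \<Rightarrow> bool" where
  "basically_empty R E B A \<longleftrightarrow>
     (\<forall>C. submodule C R B \<and> C \<subset> A \<longrightarrow>
        \<not> (\<exists>gs hs. minimal_cogenerating_set R E (quot_module R B A) gs \<and>
              minimal_cogenerating_set R E (quot_module R B C) (map (pull_back R B C A) gs @ hs)))"

end

theory Submission
  imports Defs
begin

text \<open>
  Write \<open>S\<^sup>\<bottom> \<subseteq> B\<close> for the common kernel of a set \<open>S\<close> of maps \<open>B \<rightarrow> E\<close>, and \<open>C\<^sup>\<bottom> \<subseteq> B\<^sup>\<or>\<close> for the maps that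
  vanish on \<open>C \<subseteq> B\<close>. The theorem holds because these two operations are inverse, inclusion-reversing
  bijections between the submodules of \<open>B\<close> and the finitely generated submodules of \<open>B\<^sup>\<or>\<close> over the
  completion, and because they turn cogenerating lists into generating sets:

  \<^item> \<open>C\<^sup>\<bottom>\<^sup>\<bottom> = C\<close>, since \<open>E\<close> is an injective cogenerator (\<open>separating_map\<close>, \<open>common_kernel_perp\<close>);

  \<^item> \<open>S\<close> generates \<open>S\<^sup>\<bottom>\<^sup>\<bottom>\<close> for every set \<open>S\<close> of maps (\<open>gen_submodule_dual\<close>);

  \<^item> \<open>(B/C)\<^sup>\<or>\<close> is \<open>C\<^sup>\<bottom>\<close> inside \<open>B\<^sup>\<or>\<close>, and a list of maps on \<open>B/C\<close> is cogenerating iff the common kernel of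
    the corresponding maps on \<open>B\<close> is \<open>C\<close>.

  Hence minimal cogenerating lists of \<open>B/C\<close> are the enumerations of minimal generating sets of \<open>C\<^sup>\<bottom>\<close>
  (\<open>minimal_cogenerating_set_iff\<close>), and an extension of such a list from \<open>B/A\<close> to \<open>B/C\<close> is an
  extension of a generating set from \<open>A\<^sup>\<bottom>\<close> to \<open>C\<^sup>\<bottom>\<close> (\<open>extension_iff\<close>).

  The second point carries the weight. By the descending chain condition \<open>S\<close> may be taken finite. A
  map \<open>f\<close> that vanishes on the common kernel of \<open>g\<^sub>1, \<dots>, g\<^sub>t\<close> is a sum of maps \<open>\<phi>\<^sub>i \<circ> g\<^sub>i\<close> with
  endomorphisms \<open>\<phi>\<^sub>i\<close> of \<open>E\<close>, by injectivity (\<open>vanishing_on_common_kernel\<close>). By Matlis's theorem \<open>\<phi>\<^sub>i\<close>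
  acts on the elements killed by powers of \<open>m\<close> as an element of the completion
  (\<open>endomorphism_is_completion_scalar\<close>), and every element of \<open>B\<close> is killed by a power of \<open>m\<close>
  (\<open>torsion\<close>). Matlis's theorem itself comes from the same principle without any count of lengths: an
  endomorphism that vanishes on the elements killed by \<open>m\<^sup>n\<close> vanishes on the common kernel of the
  multiplications by generators of \<open>m\<^sup>n\<close>.
\<close>


section \<open>Linear maps and linear graphs\<close>

lemma lin_mapsI:
  assumes "\<And>x. x \<in> carrier M \<Longrightarrow> f x \<in> carrier N"
    and "\<And>x. x \<notin> carrier M \<Longrightarrow> f x = undefined"
    and "\<And>x y. \<lbrakk>x \<in> carrier M; y \<in> carrier M\<rbrakk> \<Longrightarrow> f (x \<oplus>\<^bsub>M\<^esub> y) = f x \<oplus>\<^bsub>N\<^esub> f y"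
    and "\<And>r x. \<lbrakk>r \<in> carrier R; x \<in> carrier M\<rbrakk> \<Longrightarrow> f (r \<odot>\<^bsub>M\<^esub> x) = r \<odot>\<^bsub>N\<^esub> f x"
  shows "f \<in> lin_maps R M N"
  using assms unfolding lin_maps_def by (auto intro!: PiE_I)

lemma lin_mapsD:
  assumes "f \<in> lin_maps R M N"
  shows "x \<in> carrier M \<Longrightarrow> f x \<in> carrier N"
    and "\<lbrakk>x \<in> carrier M; y \<in> carrier M\<rbrakk> \<Longrightarrow> f (x \<oplus>\<^bsub>M\<^esub> y) = f x \<oplus>\<^bsub>N\<^esub> f y"
    and "\<lbrakk>r \<in> carrier R; x \<in> carrier M\<rbrakk> \<Longrightarrow> f (r \<odot>\<^bsub>M\<^esub> x) = r \<odot>\<^bsub>N\<^esub> f x"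
    and "x \<notin> carrier M \<Longrightarrow> f x = undefined"
  using assms unfolding lin_maps_def by (auto simp: PiE_def extensional_def)

lemma lin_maps_eqI:
  assumes "f \<in> lin_maps R M N" "g \<in> lin_maps R M N'"
    and "\<And>x. x \<in> carrier M \<Longrightarrow> f x = g x"
  shows "f = g"
  using assms lin_mapsD(4) by (metis ext)

lemma lin_maps_zero:
  assumes "module R M" "module R N" "f \<in> lin_maps R M N"
  shows "f \<zero>\<^bsub>M\<^esub> = \<zero>\<^bsub>N\<^esub>"
proof -
  interpret M: module R M by fact
  interpret N: module R N by fact
  have "f (\<zero>\<^bsub>R\<^esub> \<odot>\<^bsub>M\<^esub> \<zero>\<^bsub>M\<^esub>) = \<zero>\<^bsub>R\<^esub> \<odot>\<^bsub>N\<^esub> f \<zero>\<^bsub>M\<^esub>"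
    by (rule lin_mapsD(3)[OF assms(3)]) auto
  then show ?thesis using lin_mapsD(1)[OF assms(3)] by simp
qed

lemma lin_maps_minus:
  assumes "module R M" "module R N" "f \<in> lin_maps R M N" "x \<in> carrier M"
  shows "f (\<ominus>\<^bsub>M\<^esub> x) = \<ominus>\<^bsub>N\<^esub> f x"
proof -
  interpret M: module R M by fact
  interpret N: module R N by fact
  have "f (\<ominus>\<^bsub>M\<^esub> x) \<oplus>\<^bsub>N\<^esub> f x = \<zero>\<^bsub>N\<^esub>"
    using lin_mapsD(2)[OF assms(3), of "\<ominus>\<^bsub>M\<^esub> x" x] lin_maps_zero[OF assms(1-3)] assms(4)
    by (simp add: M.l_neg)
  then show ?thesis
    using lin_mapsD(1)[OF assms(3)] assms(4) by (simp add: N.minus_equality)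
qed

lemma (in module) submodule_zero: "submodule H R M \<Longrightarrow> \<zero>\<^bsub>M\<^esub> \<in> H"
  using subgroup.one_closed[OF submodule.axioms(1)] by fastforce

lemma (in module) submodule_kernel:
  assumes "module R N" "g \<in> lin_maps R M N" "submodule K R M"
  shows "submodule {x \<in> K. g x = \<zero>\<^bsub>N\<^esub>} R M"
proof -
  interpret N: module R N by fact
  note g = lin_mapsD[OF assms(2)] and K = submoduleE[OF assms(3)]
  show ?thesis
  proof (rule submoduleI)
    fix a assume "a \<in> {x \<in> K. g x = \<zero>\<^bsub>N\<^esub>}"
    then show "\<ominus>\<^bsub>M\<^esub> a \<in> {x \<in> K. g x = \<zero>\<^bsub>N\<^esub>}"
      using K lin_maps_minus[OF module_axioms assms(1,2), of a] by auto
  qed (use K g submodule_zero[OF assms(3)] lin_maps_zero[OF module_axioms assms(1,2)]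
        in \<open>auto simp: subset_iff\<close>)
qed

lemma regular_module_is_module:
  assumes "cring R"
  shows "module R (regular_module R)"
proof -
  interpret cring R by fact
  show ?thesis
  proof (rule moduleI)
    show "abelian_group (regular_module R)"
      by (rule abelian_groupI)
        (auto simp: regular_module_def add.m_ac intro: l_neg exI[of _ "\<ominus>\<^bsub>R\<^esub> _"] bexI[of _ "\<ominus>\<^bsub>R\<^esub> _"])
  qed (auto simp: regular_module_def l_distr r_distr m_assoc assms)
qed

text \<open>
  The graph of a linear map that is defined on some submodule of \<open>Y\<close> only. Such partial maps are
  extended by enlarging their graphs.
\<close>

definition linear_graph ::
    "('a, 'r) ring_scheme \<Rightarrow> ('a, 'b, 'y) module_scheme \<Rightarrow> ('a, 'e, 'z) module_scheme
      \<Rightarrow> ('b \<times> 'e) set \<Rightarrow> bool" where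
  "linear_graph R Y E G \<longleftrightarrow> G \<subseteq> carrier Y \<times> carrier E \<and> (\<zero>\<^bsub>Y\<^esub>, \<zero>\<^bsub>E\<^esub>) \<in> G \<and>
     (\<forall>y e y' e'. (y, e) \<in> G \<longrightarrow> (y', e') \<in> G \<longrightarrow> (y \<oplus>\<^bsub>Y\<^esub> y', e \<oplus>\<^bsub>E\<^esub> e') \<in> G) \<and>
     (\<forall>r y e. r \<in> carrier R \<longrightarrow> (y, e) \<in> G \<longrightarrow> (r \<odot>\<^bsub>Y\<^esub> y, r \<odot>\<^bsub>E\<^esub> e) \<in> G) \<and>
     (\<forall>e. (\<zero>\<^bsub>Y\<^esub>, e) \<in> G \<longrightarrow> e = \<zero>\<^bsub>E\<^esub>)"

lemma linear_graphD:
  assumes "linear_graph R Y E G"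
  shows "(y, e) \<in> G \<Longrightarrow> y \<in> carrier Y" "(y, e) \<in> G \<Longrightarrow> e \<in> carrier E"
    and "(\<zero>\<^bsub>Y\<^esub>, \<zero>\<^bsub>E\<^esub>) \<in> G"
    and "\<lbrakk>(y, e) \<in> G; (y', e') \<in> G\<rbrakk> \<Longrightarrow> (y \<oplus>\<^bsub>Y\<^esub> y', e \<oplus>\<^bsub>E\<^esub> e') \<in> G"
    and "\<lbrakk>r \<in> carrier R; (y, e) \<in> G\<rbrakk> \<Longrightarrow> (r \<odot>\<^bsub>Y\<^esub> y, r \<odot>\<^bsub>E\<^esub> e) \<in> G"
    and "(\<zero>\<^bsub>Y\<^esub>, e) \<in> G \<Longrightarrow> e = \<zero>\<^bsub>E\<^esub>"
  using assms unfolding linear_graph_def by blast+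

lemma linear_graph_unique:
  assumes "module R Y" "module R E" "linear_graph R Y E G" "(y, e) \<in> G" "(y, e') \<in> G"
  shows "e = e'"
proof -
  interpret Y: module R Y by fact
  interpret E: module R E by fact
  note G = linear_graphD[OF assms(3)]
  have c: "y \<in> carrier Y" "e \<in> carrier E" "e' \<in> carrier E" using G assms(4,5) by auto
  \<comment> \<open>A linear graph contains negatives because it is closed under multiplication by \<open>-1\<close>.\<close>
  have "((\<ominus>\<^bsub>R\<^esub> \<one>\<^bsub>R\<^esub>) \<odot>\<^bsub>Y\<^esub> y, (\<ominus>\<^bsub>R\<^esub> \<one>\<^bsub>R\<^esub>) \<odot>\<^bsub>E\<^esub> e') \<in> G" by (rule G) (use assms in auto)
  then have "(\<ominus>\<^bsub>Y\<^esub> y, \<ominus>\<^bsub>E\<^esub> e') \<in> G" using c by (simp add: Y.smult_l_minus E.smult_l_minus)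
  from G(4)[OF assms(4) this] have "(\<zero>\<^bsub>Y\<^esub>, e \<oplus>\<^bsub>E\<^esub> (\<ominus>\<^bsub>E\<^esub> e')) \<in> G" using c by (simp add: Y.r_neg)
  then have "e \<oplus>\<^bsub>E\<^esub> (\<ominus>\<^bsub>E\<^esub> e') = \<zero>\<^bsub>E\<^esub>" by (rule G(6))
  then show ?thesis using c by (metis E.minus_equality E.minus_minus E.a_inv_closed)
qed

section \<open>Baer's criterion\<close>

text \<open>
  The elements \<open>r\<close> of \<open>R\<close> for which \<open>r y\<close> already has an image form an ideal, and sending \<open>r\<close> to the
  image of \<open>r y\<close> is a linear map on it. By injectivity this map is multiplication by some \<open>c\<close>, which
  is then a consistent choice for the image of \<open>y\<close>.
\<close>

lemma linear_graph_extend_by_element: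
  fixes R :: "('a, 'r) ring_scheme" and E :: "('a, 'e, 'z) module_scheme"
    and Y :: "('a, 'b, 'y) module_scheme"
  assumes inj: "injective_module TYPE('a) R E" and Y: "module R Y"
    and G: "linear_graph R Y E G" and y: "y \<in> carrier Y"
  shows "\<exists>G' c. linear_graph R Y E G' \<and> G \<subseteq> G' \<and> (y, c) \<in> G'"
proof -
  have E: "module R E" using inj by (simp add: injective_module_def)
  interpret Y: module R Y by fact
  interpret E: module R E by fact
  note G' = linear_graphD[OF G] and uniq = linear_graph_unique[OF Y E G]
  define I where "I = {r \<in> carrier R. \<exists>e. (r \<odot>\<^bsub>Y\<^esub> y, e) \<in> G}"
  define h where "h = (\<lambda>r\<in>I. THE e. (r \<odot>\<^bsub>Y\<^esub> y, e) \<in> G)"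
  have h: "h r = e" if "r \<in> carrier R" "(r \<odot>\<^bsub>Y\<^esub> y, e) \<in> G" for r e
    unfolding h_def I_def using that by (auto intro: the_equality dest: uniq)
  have hG: "(r \<odot>\<^bsub>Y\<^esub> y, h r) \<in> G" if "r \<in> I" for r
    using that h unfolding I_def by fast
  have IC: "I \<subseteq> carrier R" by (auto simp: I_def)
  have add: "(((r \<oplus>\<^bsub>R\<^esub> r') \<odot>\<^bsub>Y\<^esub> y), h r \<oplus>\<^bsub>E\<^esub> h r') \<in> G" if "r \<in> I" "r' \<in> I" for r r'
    using G'(4)[OF hG[OF that(1)] hG[OF that(2)]] that IC y
    by (auto simp: Y.smult_l_distr subset_iff)
  have smu: "(((s \<otimes>\<^bsub>R\<^esub> r) \<odot>\<^bsub>Y\<^esub> y), s \<odot>\<^bsub>E\<^esub> h r) \<in> G" if "r \<in> I" "s \<in> carrier R" for r s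
    using G'(5)[OF that(2) hG[OF that(1)]] that IC y by (auto simp: Y.smult_assoc1 subset_iff)
  let ?Rm = "regular_module R"
  interpret Rm: module R ?Rm by (rule regular_module_is_module) (rule Y.R.is_cring)
  have sub: "submodule I R ?Rm"
  proof (rule Rm.submoduleI)
    have min: "\<ominus>\<^bsub>?Rm\<^esub> r = (\<ominus>\<^bsub>R\<^esub> \<one>\<^bsub>R\<^esub>) \<otimes>\<^bsub>R\<^esub> r" if "r \<in> carrier R" for r
      using Rm.smult_l_minus[of "\<one>\<^bsub>R\<^esub>" r] that by (simp add: regular_module_def)
    show "\<ominus>\<^bsub>?Rm\<^esub> r \<in> I" if "r \<in> I" for r
      using smu[OF that, of "\<ominus>\<^bsub>R\<^esub> \<one>\<^bsub>R\<^esub>"] min[of r] that IC by (auto simp: I_def)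
    show "\<zero>\<^bsub>?Rm\<^esub> \<in> I" using G'(3) y by (auto simp: I_def regular_module_def)
    show "a \<oplus>\<^bsub>?Rm\<^esub> b \<in> I" if "a \<in> I" "b \<in> I" for a b
      using add[OF that] that by (auto simp: I_def regular_module_def)
    show "a \<odot>\<^bsub>?Rm\<^esub> b \<in> I" if "a \<in> carrier R" "b \<in> I" for a b
      using smu[OF that(2,1)] that by (auto simp: I_def regular_module_def)
  qed (auto simp: I_def regular_module_def)
  have hlin: "h \<in> lin_maps R (?Rm\<lparr>carrier := I\<rparr>) E"
  proof (rule lin_mapsI)
    fix r r' assume r: "r \<in> carrier (?Rm\<lparr>carrier := I\<rparr>)"
    show "h r \<in> carrier E" using r G'(2) hG by auto
    show "h (r \<oplus>\<^bsub>?Rm\<lparr>carrier := I\<rparr>\<^esub> r') = h r \<oplus>\<^bsub>E\<^esub> h r'"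
      if "r' \<in> carrier (?Rm\<lparr>carrier := I\<rparr>)"
      using h[OF _ add[of r r']] r that IC by (auto simp: regular_module_def subset_iff)
    show "h (s \<odot>\<^bsub>?Rm\<lparr>carrier := I\<rparr>\<^esub> r) = s \<odot>\<^bsub>E\<^esub> h r" if "s \<in> carrier R" for s
      using h[OF _ smu[of r s]] r that IC by (auto simp: regular_module_def subset_iff)
  qed (auto simp: h_def)
  obtain g where g: "g \<in> lin_maps R ?Rm E" "\<And>r. r \<in> I \<Longrightarrow> g r = h r"
    using inj Rm.module_axioms sub hlin unfolding injective_module_def by blast
  define c where "c = g \<one>\<^bsub>R\<^esub>"
  have c: "c \<in> carrier E"
    unfolding c_def by (rule lin_mapsD(1)[OF g(1)]) (auto simp: regular_module_def)
  have hc: "h r = r \<odot>\<^bsub>E\<^esub> c" if "r \<in> I" for r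
    using lin_mapsD(3)[OF g(1), of r "\<one>\<^bsub>R\<^esub>"] g(2)[OF that] that IC
    by (auto simp: regular_module_def c_def subset_iff)
  define G1 where "G1 = {(w \<oplus>\<^bsub>Y\<^esub> r \<odot>\<^bsub>Y\<^esub> y, e \<oplus>\<^bsub>E\<^esub> r \<odot>\<^bsub>E\<^esub> c) | w e r. (w, e) \<in> G \<and> r \<in> carrier R}"
  have in_G1: "(w \<oplus>\<^bsub>Y\<^esub> r \<odot>\<^bsub>Y\<^esub> y, e \<oplus>\<^bsub>E\<^esub> r \<odot>\<^bsub>E\<^esub> c) \<in> G1" if "(w, e) \<in> G" "r \<in> carrier R" for w e r
    using that by (auto simp: G1_def)
  have GG1: "G \<subseteq> G1"
    using in_G1[of _ _ "\<zero>\<^bsub>R\<^esub>"] G'(1,2) y c by fastforce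
  moreover have "(y, c) \<in> G1" using in_G1[OF G'(3), of "\<one>\<^bsub>R\<^esub>"] y c by simp
  moreover have "linear_graph R Y E G1"
    unfolding linear_graph_def
  proof (intro conjI allI impI)
    show "G1 \<subseteq> carrier Y \<times> carrier E" using G'(1,2) y c by (auto simp: G1_def)
    show "(\<zero>\<^bsub>Y\<^esub>, \<zero>\<^bsub>E\<^esub>) \<in> G1" using GG1 G'(3) by blast
    fix u f assume "(u, f) \<in> G1"
    then obtain w e r where r: "(w, e) \<in> G" "r \<in> carrier R"
      "u = w \<oplus>\<^bsub>Y\<^esub> r \<odot>\<^bsub>Y\<^esub> y" "f = e \<oplus>\<^bsub>E\<^esub> r \<odot>\<^bsub>E\<^esub> c"
      by (auto simp: G1_def)
    have rc: "w \<in> carrier Y" "e \<in> carrier E" using r G' by auto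
    {
      fix u' f' assume "(u', f') \<in> G1"
      then obtain w' e' r' where r': "(w', e') \<in> G" "r' \<in> carrier R"
        "u' = w' \<oplus>\<^bsub>Y\<^esub> r' \<odot>\<^bsub>Y\<^esub> y" "f' = e' \<oplus>\<^bsub>E\<^esub> r' \<odot>\<^bsub>E\<^esub> c"
        by (auto simp: G1_def)
      have rc': "w' \<in> carrier Y" "e' \<in> carrier E" using r' G' by auto
      have "u \<oplus>\<^bsub>Y\<^esub> u' = (w \<oplus>\<^bsub>Y\<^esub> w') \<oplus>\<^bsub>Y\<^esub> (r \<oplus>\<^bsub>R\<^esub> r') \<odot>\<^bsub>Y\<^esub> y"
        "f \<oplus>\<^bsub>E\<^esub> f' = (e \<oplus>\<^bsub>E\<^esub> e') \<oplus>\<^bsub>E\<^esub> (r \<oplus>\<^bsub>R\<^esub> r') \<odot>\<^bsub>E\<^esub> c"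
        using r r' rc rc' y c
        by (simp_all add: Y.smult_l_distr E.smult_l_distr Y.add.m_ac E.add.m_ac)
      then show "(u \<oplus>\<^bsub>Y\<^esub> u', f \<oplus>\<^bsub>E\<^esub> f') \<in> G1"
        using in_G1[OF G'(4)[OF r(1) r'(1)], of "r \<oplus>\<^bsub>R\<^esub> r'"] r r' by simp
    }
    fix s assume s: "s \<in> carrier R"
    have "s \<odot>\<^bsub>Y\<^esub> u = s \<odot>\<^bsub>Y\<^esub> w \<oplus>\<^bsub>Y\<^esub> (s \<otimes>\<^bsub>R\<^esub> r) \<odot>\<^bsub>Y\<^esub> y"
      "s \<odot>\<^bsub>E\<^esub> f = s \<odot>\<^bsub>E\<^esub> e \<oplus>\<^bsub>E\<^esub> (s \<otimes>\<^bsub>R\<^esub> r) \<odot>\<^bsub>E\<^esub> c"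
      using r rc y c s
      by (simp_all add: Y.smult_r_distr E.smult_r_distr Y.smult_assoc1 E.smult_assoc1)
    then show "(s \<odot>\<^bsub>Y\<^esub> u, s \<odot>\<^bsub>E\<^esub> f) \<in> G1"
      using in_G1[OF G'(5)[OF s r(1)], of "s \<otimes>\<^bsub>R\<^esub> r"] r s by simp
  next
    fix f assume "(\<zero>\<^bsub>Y\<^esub>, f) \<in> G1"
    then obtain w e r where r: "(w, e) \<in> G" "r \<in> carrier R"
      "\<zero>\<^bsub>Y\<^esub> = w \<oplus>\<^bsub>Y\<^esub> r \<odot>\<^bsub>Y\<^esub> y" "f = e \<oplus>\<^bsub>E\<^esub> r \<odot>\<^bsub>E\<^esub> c"
      by (auto simp: G1_def)
    have rc: "w \<in> carrier Y" "e \<in> carrier E" using r G' by auto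
    have "((\<ominus>\<^bsub>R\<^esub> \<one>\<^bsub>R\<^esub>) \<odot>\<^bsub>Y\<^esub> w, (\<ominus>\<^bsub>R\<^esub> \<one>\<^bsub>R\<^esub>) \<odot>\<^bsub>E\<^esub> e) \<in> G" by (rule G'(5)) (use r in auto)
    then have "(\<ominus>\<^bsub>Y\<^esub> w, \<ominus>\<^bsub>E\<^esub> e) \<in> G" using rc by (simp add: Y.smult_l_minus E.smult_l_minus)
    moreover have "\<ominus>\<^bsub>Y\<^esub> w = r \<odot>\<^bsub>Y\<^esub> y"
      using r rc y by (metis Y.M.a_comm Y.M.minus_equality Y.smult_closed)
    ultimately have rG: "(r \<odot>\<^bsub>Y\<^esub> y, \<ominus>\<^bsub>E\<^esub> e) \<in> G" by simp
    then have "r \<in> I" using r by (auto simp: I_def)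
    then have "r \<odot>\<^bsub>E\<^esub> c = \<ominus>\<^bsub>E\<^esub> e" using h[OF r(2) rG] hc by simp
    then show "f = \<zero>\<^bsub>E\<^esub>" using r rc by (simp add: E.r_neg)
  qed
  ultimately show ?thesis by blast
qed

lemma linear_graph_Union_chain:
  assumes "\<C> \<noteq> {}" "subset.chain {G. linear_graph R Y E G} \<C>"
  shows "linear_graph R Y E (\<Union>\<C>)"
proof -
  have G: "linear_graph R Y E G" if "G \<in> \<C>" for G
    using assms(2) that by (auto simp: subset_chain_def)
  have add: "(y \<oplus>\<^bsub>Y\<^esub> y', e \<oplus>\<^bsub>E\<^esub> e') \<in> \<Union>\<C>"
    if "G \<in> \<C>" "(y, e) \<in> G" "G' \<in> \<C>" "(y', e') \<in> G'" for G G' y e y' e'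
  proof -
    have "G \<subseteq> G' \<or> G' \<subseteq> G" using assms(2) that by (auto simp: subset_chain_def)
    then show ?thesis
    proof
      assume "G \<subseteq> G'"
      then show ?thesis using linear_graphD(4)[OF G[OF that(3)], of y e y' e'] that by auto
    next
      assume "G' \<subseteq> G"
      then show ?thesis using linear_graphD(4)[OF G[OF that(1)], of y e y' e'] that by auto
    qed
  qed
  show ?thesis
    unfolding linear_graph_def
    apply (intro conjI allI impI)
    subgoal using linear_graphD(1,2)[OF G] by auto
    subgoal using linear_graphD(3)[OF G] assms(1) by auto
    subgoal using add by blast
    subgoal using linear_graphD(5)[OF G] by blast
    subgoal using linear_graphD(6)[OF G] by blast
    done
qed

text \<open>
  Zorn's lemma completes the extension. The carrier type of \<open>Y\<close> is arbitrary, whereas injectivity is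
  assumed for test modules over the carrier type of \<open>R\<close> only: the extension by one element tests with
  ideals alone.
\<close>

theorem linear_graph_extends:
  fixes R :: "('a, 'r) ring_scheme" and E :: "('a, 'e, 'z) module_scheme"
    and Y :: "('a, 'b, 'y) module_scheme"
  assumes inj: "injective_module TYPE('a) R E" and Y: "module R Y"
    and G: "linear_graph R Y E G"
  shows "\<exists>g\<in>lin_maps R Y E. \<forall>(y, e)\<in>G. g y = e"
proof -
  have E: "module R E" using inj by (simp add: injective_module_def)
  let ?A = "{G'. linear_graph R Y E G' \<and> G \<subseteq> G'}"
  have "\<exists>M\<in>?A. \<forall>Z\<in>?A. M \<subseteq> Z \<longrightarrow> Z = M"
  proof (rule subset_Zorn_nonempty)
    show "?A \<noteq> {}" using G by blast
    fix \<C> assume C: "\<C> \<noteq> {}" "subset.chain ?A \<C>"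
    then have "subset.chain {G. linear_graph R Y E G} \<C>" by (auto simp: subset_chain_def)
    then show "\<Union>\<C> \<in> ?A" using linear_graph_Union_chain[OF C(1)] C
      by (fastforce simp: subset_chain_def)
  qed
  then obtain M where M: "linear_graph R Y E M" "G \<subseteq> M"
    "\<And>Z. \<lbrakk>linear_graph R Y E Z; M \<subseteq> Z\<rbrakk> \<Longrightarrow> Z = M"
    by (smt (verit) mem_Collect_eq order_trans)
  note M' = linear_graphD[OF M(1)] and uniq = linear_graph_unique[OF Y E M(1)]
  define g where "g = (\<lambda>y\<in>carrier Y. THE e. (y, e) \<in> M)"
  have g: "g y = e" if "(y, e) \<in> M" for y e
    using that M'(1)[OF that] unfolding g_def by (auto intro: the_equality dest: uniq)
  have gM: "(y, g y) \<in> M" if "y \<in> carrier Y" for y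
    using linear_graph_extend_by_element[OF inj Y M(1) that] M(3) g by metis
  have "g \<in> lin_maps R Y E"
  proof (rule lin_mapsI)
    fix x assume x: "x \<in> carrier Y"
    show "g x \<in> carrier E" by (rule M'(2)[OF gM[OF x]])
    show "g (x \<oplus>\<^bsub>Y\<^esub> y) = g x \<oplus>\<^bsub>E\<^esub> g y" if "y \<in> carrier Y" for y
      by (rule g[OF M'(4)[OF gM[OF x] gM[OF that]]])
    show "g (r \<odot>\<^bsub>Y\<^esub> x) = r \<odot>\<^bsub>E\<^esub> g x" if "r \<in> carrier R" for r
      by (rule g[OF M'(5)[OF that gM[OF x]]])
  qed (simp add: g_def)
  then show ?thesis using g M(2) by blast
qed

section \<open>Maps that vanish on a common kernel\<close>

text \<open>
  If \<open>f\<close> vanishes wherever all maps of a finite set \<open>S\<close> vanish, then \<open>f\<close> is a sum of maps \<open>\<phi> \<circ> g\<close>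
  with \<open>g \<in> S\<close> and \<open>\<phi>\<close> an endomorphism of \<open>E\<close>. Splitting off one \<open>g\<close> at a time keeps this within
  \<open>E\<close> itself and avoids powers of \<open>E\<close>: on \<open>K \<inter> ker g\<close> the claim holds for the smaller set, and
  what remains of \<open>f\<close> vanishes on \<open>K \<inter> ker g\<close>, hence factors through \<open>g ` K \<subseteq> E\<close> and
  extends to \<open>E\<close> by injectivity. The set \<open>H\<close> stands for the sums that are under consideration.
\<close>

lemma vanishing_on_common_kernel:
  fixes R :: "('a, 'r) ring_scheme" and E :: "('a, 'e, 'z) module_scheme"
    and B :: "('a, 'b, 'y) module_scheme"
  assumes inj: "injective_module TYPE('a) R E" and B: "module R B"
    and H: "H \<subseteq> lin_maps R B E" "(\<lambda>x\<in>carrier B. \<zero>\<^bsub>E\<^esub>) \<in> H"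
      "\<And>h h'. \<lbrakk>h \<in> H; h' \<in> H\<rbrakk> \<Longrightarrow> (\<lambda>x\<in>carrier B. h x \<oplus>\<^bsub>E\<^esub> h' x) \<in> H"
    and f: "f \<in> lin_maps R B E"
    and "finite S" "S \<subseteq> lin_maps R B E" "submodule K R B"
    and "\<And>g \<phi>. \<lbrakk>g \<in> S; \<phi> \<in> lin_maps R E E\<rbrakk> \<Longrightarrow> \<exists>h\<in>H. \<forall>x\<in>K. h x = \<phi> (g x)"
    and "\<And>x. \<lbrakk>x \<in> K; \<forall>g\<in>S. g x = \<zero>\<^bsub>E\<^esub>\<rbrakk> \<Longrightarrow> f x = \<zero>\<^bsub>E\<^esub>"
  shows "\<exists>h\<in>H. \<forall>x\<in>K. f x = h x"
  using assms(7-)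
proof (induction S arbitrary: K rule: finite_induct)
  interpret B: module R B by fact
  case empty
  then show ?case using H(2) B.submoduleE(1)[OF empty(2)] by (intro bexI[OF _ H(2)]) auto
next
  case (insert g S)
  interpret B: module R B by fact
  have E: "module R E" using inj by (simp add: injective_module_def)
  interpret E: module R E by fact
  have g: "g \<in> lin_maps R B E" and S: "S \<subseteq> lin_maps R B E" using insert.prems(1) by auto
  note K = B.submoduleE[OF insert.prems(2)]
  have KB: "x \<in> carrier B" if "x \<in> K" for x using K(1) that by auto
  let ?K = "{x \<in> K. g x = \<zero>\<^bsub>E\<^esub>}"
  have "\<exists>h\<in>H. \<forall>x\<in>?K. f x = h x"
  proof (rule insert.IH)
    show "submodule ?K R B" by (rule B.submodule_kernel[OF E g insert.prems(2)])
    show "\<exists>h\<in>H. \<forall>x\<in>?K. h x = \<phi> (g' x)" if "g' \<in> S" "\<phi> \<in> lin_maps R E E" for g' \<phi>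
      using insert.prems(3)[of g' \<phi>] that by auto
  qed (use S insert.prems(4) in auto)
  then obtain h where h: "h \<in> H" "\<And>x. \<lbrakk>x \<in> K; g x = \<zero>\<^bsub>E\<^esub>\<rbrakk> \<Longrightarrow> f x = h x" by auto
  have hl: "h \<in> lin_maps R B E" using h H(1) by auto
  note fD = lin_mapsD[OF f] and gD = lin_mapsD[OF g] and hD = lin_mapsD[OF hl]
  let ?G = "(\<lambda>x. (g x, f x \<ominus>\<^bsub>E\<^esub> h x)) ` K"
  have "linear_graph R E E ?G"
    unfolding linear_graph_def
  proof (intro conjI allI impI)
    show "?G \<subseteq> carrier E \<times> carrier E" using KB fD gD hD by auto
    have minus0: "\<ominus>\<^bsub>E\<^esub> \<zero>\<^bsub>E\<^esub> = \<zero>\<^bsub>E\<^esub>" by (rule E.M.minus_equality) auto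
    have "\<zero>\<^bsub>B\<^esub> \<in> K" by (rule B.submodule_zero) fact
    then show "(\<zero>\<^bsub>E\<^esub>, \<zero>\<^bsub>E\<^esub>) \<in> ?G"
      by (intro image_eqI[of _ _ "\<zero>\<^bsub>B\<^esub>"])
        (simp_all add: E.minus_eq lin_maps_zero[OF B E f] lin_maps_zero[OF B E g] lin_maps_zero[OF B E hl] minus0)
    fix u e assume "(u, e) \<in> ?G"
    then obtain x where x: "x \<in> K" "u = g x" "e = f x \<ominus>\<^bsub>E\<^esub> h x" by auto
    have xc: "x \<in> carrier B" "f x \<in> carrier E" "h x \<in> carrier E" "g x \<in> carrier E"
      using KB x fD gD hD by auto
    {
      fix u' e' assume "(u', e') \<in> ?G"
      then obtain x' where x': "x' \<in> K" "u' = g x'" "e' = f x' \<ominus>\<^bsub>E\<^esub> h x'" by auto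
      have xc': "x' \<in> carrier B" "f x' \<in> carrier E" "h x' \<in> carrier E" "g x' \<in> carrier E"
        using KB x' fD gD hD by auto
      show "(u \<oplus>\<^bsub>E\<^esub> u', e \<oplus>\<^bsub>E\<^esub> e') \<in> ?G"
        using x x' xc xc' K(5) fD(2) gD(2) hD(2)
        by (intro image_eqI[of _ _ "x \<oplus>\<^bsub>B\<^esub> x'"])
          (auto simp: E.minus_eq E.M.minus_add E.add.m_ac)
    }
    fix r assume r: "r \<in> carrier R"
    show "(r \<odot>\<^bsub>E\<^esub> u, r \<odot>\<^bsub>E\<^esub> e) \<in> ?G"
      using x xc r K(4) fD(3) gD(3) hD(3)
      by (intro image_eqI[of _ _ "r \<odot>\<^bsub>B\<^esub> x"])
        (auto simp: E.minus_eq E.smult_r_distr E.smult_r_minus)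
  next
    fix e assume "(\<zero>\<^bsub>E\<^esub>, e) \<in> ?G"
    then show "e = \<zero>\<^bsub>E\<^esub>" using h(2) hD KB by (auto simp: E.minus_eq E.r_neg)
  qed
  from linear_graph_extends[OF inj E this] obtain \<phi>
    where \<phi>: "\<phi> \<in> lin_maps R E E" "\<And>x. x \<in> K \<Longrightarrow> \<phi> (g x) = f x \<ominus>\<^bsub>E\<^esub> h x" by auto
  obtain h' where h': "h' \<in> H" "\<And>x. x \<in> K \<Longrightarrow> h' x = \<phi> (g x)"
    using insert.prems(3)[of g \<phi>] \<phi> by auto
  show ?case
  proof (intro bexI ballI)
    show "(\<lambda>x\<in>carrier B. h x \<oplus>\<^bsub>E\<^esub> h' x) \<in> H" by (rule H(3)[OF h(1) h'(1)])
    fix x assume x: "x \<in> K"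
    have "f x \<in> carrier E" "h x \<in> carrier E" using x KB fD hD by auto
    then show "f x = (\<lambda>x\<in>carrier B. h x \<oplus>\<^bsub>E\<^esub> h' x) x"
      using x KB h' \<phi> by (simp add: E.minus_eq E.add.m_lcomm E.r_neg)
  qed
qed

section \<open>Quotient modules\<close>

context module
begin

lemma submodule_abelian_subgroup:
  assumes "submodule A R M"
  shows "abelian_subgroup A M"
  using submodule.axioms(1)[OF assms] M.abelian_group_axioms
  by (intro abelian_subgroupI3) (auto simp: additive_subgroup_def)

lemma submodule_coset_eq_iff:
  assumes "submodule A R M" "x \<in> carrier M" "y \<in> carrier M"
  shows "A +>\<^bsub>M\<^esub> x = A +>\<^bsub>M\<^esub> y \<longleftrightarrow> x \<oplus>\<^bsub>M\<^esub> (\<ominus>\<^bsub>M\<^esub> y) \<in> A"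
proof -
  interpret A: abelian_subgroup A M by (rule submodule_abelian_subgroup[OF assms(1)])
  have "A +>\<^bsub>M\<^esub> x = A +>\<^bsub>M\<^esub> y \<longleftrightarrow> x \<in> A +>\<^bsub>M\<^esub> y"
    using A.a_rcos_self[OF assms(2)] A.a_repr_independence'[of x y] assms(3) by auto
  also have "\<dots> \<longleftrightarrow> x \<oplus>\<^bsub>M\<^esub> (\<ominus>\<^bsub>M\<^esub> y) \<in> A" by (rule A.a_rcos_module[OF assms(3,2)])
  finally show ?thesis .
qed

lemma quot_module_carrier: "carrier (quot_module R M A) = (\<lambda>x. A +>\<^bsub>M\<^esub> x) ` carrier M"
  by (auto simp: quot_module_def A_RCOSETS_def')

lemma quot_module_add:
  assumes "submodule A R M" "x \<in> carrier M" "y \<in> carrier M"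
  shows "(A +>\<^bsub>M\<^esub> x) \<oplus>\<^bsub>quot_module R M A\<^esub> (A +>\<^bsub>M\<^esub> y) = A +>\<^bsub>M\<^esub> (x \<oplus>\<^bsub>M\<^esub> y)"
  using abelian_subgroup.a_rcos_sum[OF submodule_abelian_subgroup[OF assms(1)] assms(2,3)]
  by (simp add: quot_module_def)

lemma quot_module_smult:
  assumes "submodule A R M" "r \<in> carrier R" "x \<in> carrier M"
  shows "r \<odot>\<^bsub>quot_module R M A\<^esub> (A +>\<^bsub>M\<^esub> x) = A +>\<^bsub>M\<^esub> (r \<odot>\<^bsub>M\<^esub> x)"
proof -
  interpret A: abelian_subgroup A M by (rule submodule_abelian_subgroup[OF assms(1)])
  have const: "A +>\<^bsub>M\<^esub> (r \<odot>\<^bsub>M\<^esub> x') = A +>\<^bsub>M\<^esub> (r \<odot>\<^bsub>M\<^esub> x)" if x': "x' \<in> A +>\<^bsub>M\<^esub> x" for x'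
  proof -
    have c: "x' \<in> carrier M"
      using x' assms(3) A.a_subset M.a_r_coset_subset_G by blast
    have "x' \<oplus>\<^bsub>M\<^esub> (\<ominus>\<^bsub>M\<^esub> x) \<in> A"
      using x' c A.a_rcos_module[OF assms(3)] by simp
    then have "r \<odot>\<^bsub>M\<^esub> (x' \<oplus>\<^bsub>M\<^esub> (\<ominus>\<^bsub>M\<^esub> x)) \<in> A" using submoduleE(4)[OF assms(1,2)] by simp
    then show ?thesis
      using submodule_coset_eq_iff[OF assms(1), of "r \<odot>\<^bsub>M\<^esub> x'" "r \<odot>\<^bsub>M\<^esub> x"] c assms(2,3)
      by (simp add: smult_r_distr smult_r_minus)
  qed
  have "A +>\<^bsub>M\<^esub> x \<noteq> {}" using A.a_rcos_self[OF assms(3)] by blast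
  then have "(\<Union>x'\<in>A +>\<^bsub>M\<^esub> x. A +>\<^bsub>M\<^esub> (r \<odot>\<^bsub>M\<^esub> x')) = A +>\<^bsub>M\<^esub> (r \<odot>\<^bsub>M\<^esub> x)"
    by (rule SUP_eq_const) (rule const)
  then show ?thesis by (simp add: quot_module_def)
qed

lemma coset_eq_submodule_iff:
  assumes "submodule A R M" "x \<in> carrier M"
  shows "A +>\<^bsub>M\<^esub> x = A \<longleftrightarrow> x \<in> A"
  using abelian_subgroup.a_rcos_self[OF submodule_abelian_subgroup[OF assms(1)] assms(2)]
    M.a_coset_join2[OF assms(2) submodule.axioms(1)[OF assms(1)]] by auto

lemma smult_left_commute:
  assumes "r \<in> carrier R" "s \<in> carrier R" "y \<in> carrier M"
  shows "r \<odot>\<^bsub>M\<^esub> (s \<odot>\<^bsub>M\<^esub> y) = s \<odot>\<^bsub>M\<^esub> (r \<odot>\<^bsub>M\<^esub> y)"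
proof -
  have "r \<odot>\<^bsub>M\<^esub> (s \<odot>\<^bsub>M\<^esub> y) = (r \<otimes> s) \<odot>\<^bsub>M\<^esub> y" by (simp only: smult_assoc1[OF assms])
  also have "\<dots> = (s \<otimes> r) \<odot>\<^bsub>M\<^esub> y" by (rule arg_cong[OF R.m_comm[OF assms(1,2)]])
  also have "\<dots> = s \<odot>\<^bsub>M\<^esub> (r \<odot>\<^bsub>M\<^esub> y)" by (simp only: smult_assoc1[OF assms(2,1,3)])
  finally show ?thesis .
qed

lemma submodule_cyclic:
  assumes x: "x \<in> carrier M"
  shows "submodule ((\<lambda>r. r \<odot>\<^bsub>M\<^esub> x) ` carrier R) R M"
proof (rule submoduleI)
  show "\<zero>\<^bsub>M\<^esub> \<in> (\<lambda>r. r \<odot>\<^bsub>M\<^esub> x) ` carrier R" using x by (intro image_eqI[of _ _ \<zero>]) auto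
  show "\<ominus>\<^bsub>M\<^esub> u \<in> (\<lambda>r. r \<odot>\<^bsub>M\<^esub> x) ` carrier R" if "u \<in> (\<lambda>r. r \<odot>\<^bsub>M\<^esub> x) ` carrier R" for u
    using that x by (auto simp: smult_l_minus[symmetric])
  show "u \<oplus>\<^bsub>M\<^esub> v \<in> (\<lambda>r. r \<odot>\<^bsub>M\<^esub> x) ` carrier R"
    if "u \<in> (\<lambda>r. r \<odot>\<^bsub>M\<^esub> x) ` carrier R" "v \<in> (\<lambda>r. r \<odot>\<^bsub>M\<^esub> x) ` carrier R" for u v
    using that x by (auto simp: smult_l_distr[symmetric])
  show "r \<odot>\<^bsub>M\<^esub> u \<in> (\<lambda>r. r \<odot>\<^bsub>M\<^esub> x) ` carrier R"
    if "r \<in> carrier R" "u \<in> (\<lambda>r. r \<odot>\<^bsub>M\<^esub> x) ` carrier R" for r u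
    using that x by (auto simp: smult_assoc1[symmetric])
qed (use x in auto)

definition annihilated_by :: "'a set \<Rightarrow> 'c set" where
  "annihilated_by J = {x \<in> carrier M. \<forall>a\<in>J. a \<odot>\<^bsub>M\<^esub> x = \<zero>\<^bsub>M\<^esub>}"

lemma submodule_annihilated_by:
  assumes "J \<subseteq> carrier R"
  shows "submodule (annihilated_by J) R M"
proof (rule submoduleI)
  fix r x assume "r \<in> carrier R" "x \<in> annihilated_by J"
  moreover have "a \<odot>\<^bsub>M\<^esub> (r \<odot>\<^bsub>M\<^esub> x) = r \<odot>\<^bsub>M\<^esub> (a \<odot>\<^bsub>M\<^esub> x)"
    if "a \<in> J" "r \<in> carrier R" "x \<in> carrier M" for a
    using that assms by (metis R.m_comm smult_assoc1 subsetD)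
  ultimately show "r \<odot>\<^bsub>M\<^esub> x \<in> annihilated_by J" by (simp add: annihilated_by_def)
next
  show "\<ominus>\<^bsub>M\<^esub> x \<in> annihilated_by J" if "x \<in> annihilated_by J" for x
    using that assms M.minus_equality[of "\<zero>\<^bsub>M\<^esub>" "\<zero>\<^bsub>M\<^esub>"]
    by (auto simp: annihilated_by_def smult_r_minus subset_iff)
qed (use assms in \<open>auto simp: annihilated_by_def smult_r_distr subset_iff\<close>)

text \<open>The annihilator of an element is an ideal, so it contains \<open>Idl F\<close> as soon as it contains \<open>F\<close>.\<close>

lemma annihilated_by_genideal:
  assumes "F \<subseteq> carrier R"
  shows "annihilated_by (Idl F) = annihilated_by F"
proof
  show "annihilated_by (Idl F) \<subseteq> annihilated_by F"
    using R.genideal_self[OF assms] by (auto simp: annihilated_by_def)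
  show "annihilated_by F \<subseteq> annihilated_by (Idl F)"
  proof
    fix x assume x: "x \<in> annihilated_by F"
    then have xc: "x \<in> carrier M" by (simp add: annihilated_by_def)
    let ?J = "{a \<in> carrier R. a \<odot>\<^bsub>M\<^esub> x = \<zero>\<^bsub>M\<^esub>}"
    have "ideal ?J R"
    proof (rule idealI[OF R.ring_axioms])
      show "subgroup ?J (add_monoid R)"
        using xc M.minus_equality[of "\<zero>\<^bsub>M\<^esub>" "\<zero>\<^bsub>M\<^esub>"]
        by (intro R.add.subgroupI) (auto simp: smult_l_distr smult_l_minus intro: R.zero_closed)
      show "r \<otimes> a \<in> ?J" if "a \<in> ?J" "r \<in> carrier R" for a r
        using that xc by (auto simp: smult_assoc1)
      then show "a \<otimes> r \<in> ?J" if "a \<in> ?J" "r \<in> carrier R" for a r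
        using that by (metis (no_types, lifting) R.m_comm mem_Collect_eq)
    qed
    moreover have "F \<subseteq> ?J" using x assms by (auto simp: annihilated_by_def)
    ultimately have "Idl F \<subseteq> ?J" by (rule R.genideal_minimal)
    then show "x \<in> annihilated_by (Idl F)" using xc by (auto simp: annihilated_by_def)
  qed
qed

end

section \<open>Noetherian local rings\<close>

locale noetherian_local_ring =
  fixes R :: "('a, 'r) ring_scheme" (structure) and m :: "'a set"
  assumes noetherian: "noetherian_ring R" and local: "local_ring R m"
begin

sublocale R: cring R using local by (simp add: local_ring_def)
sublocale R: noetherian_ring R by (rule noetherian)

lemma maximal: "maximalideal m R" and ideal_m: "ideal m R"
  and maximal_unique: "maximalideal n R \<Longrightarrow> n = m"
  using local by (auto simp: local_ring_def maximalideal_def)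

lemma m_subset: "m \<subseteq> carrier R"
  using ideal.Icarr[OF ideal_m] by auto

lemma one_notin_m: "\<one> \<notin> m"
  using ideal.one_imp_carrier[OF ideal_m] maximalideal.I_notcarr[OF maximal] by auto

text \<open>A proper principal ideal would be contained in a maximal ideal, hence in \<open>m\<close>.\<close>

lemma unit_if_notin_m:
  assumes r: "r \<in> carrier R" "r \<notin> m"
  obtains s where "s \<in> carrier R" "s \<otimes> r = \<one>"
proof -
  have "\<one> \<in> PIdl r"
  proof (rule ccontr)
    assume "\<one> \<notin> PIdl r"
    let ?A = "{I. ideal I R \<and> r \<in> I \<and> \<one> \<notin> I}"
    have "\<exists>M\<in>?A. \<forall>I\<in>?A. M \<subseteq> I \<longrightarrow> I = M"
    proof (rule subset_Zorn_nonempty)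
      show "?A \<noteq> {}"
        using R.cgenideal_ideal[OF r(1)] R.cgenideal_self[OF r(1)] \<open>\<one> \<notin> PIdl r\<close> by blast
      fix \<C> assume "\<C> \<noteq> {}" "subset.chain ?A \<C>"
      moreover from this have "\<Union>\<C> \<in> \<C>"
        by (intro R.ideal_chain_is_trivial) (auto simp: subset_chain_def)
      ultimately show "\<Union>\<C> \<in> ?A" by (auto simp: subset_chain_def)
    qed
    then obtain M where M: "ideal M R" "r \<in> M" "\<one> \<notin> M"
      "\<And>I. \<lbrakk>ideal I R; \<one> \<notin> I; M \<subseteq> I\<rbrakk> \<Longrightarrow> I = M" by blast
    have "maximalideal M R"
    proof (rule maximalidealI[OF M(1)])
      show "carrier R \<noteq> M" using M(3) by auto
      show "J = M \<or> J = carrier R" if "ideal J R" "M \<subseteq> J" for J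
        using M(4)[OF that(1) _ that(2)] ideal.one_imp_carrier[OF that(1)] by blast
    qed
    then show False using maximal_unique M(2) r(2) by auto
  qed
  then show thesis using that by (auto simp: cgenideal_def)
qed

lemma ideal_power_0: "ideal_power R m 0 = carrier R"
  by (simp add: ideals_set_def nat_pow_def)

lemma ideal_power_Suc: "ideal_power R m (Suc n) = ideal_prod R (ideal_power R m n) m"
  by (simp add: ideals_set_def nat_pow_def)

lemma ideal_ideal_power: "ideal (ideal_power R m n) R"
proof (induction n)
  case 0
  show ?case unfolding ideal_power_0 by (rule R.oneideal)
next
  case (Suc n)
  show ?case unfolding ideal_power_Suc by (rule R.ideal_prod_is_ideal[OF Suc ideal_m])
qed

lemma ideal_power_subset: "ideal_power R m n \<subseteq> carrier R"
  using ideal.Icarr[OF ideal_ideal_power] by auto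

lemma ideal_power_antimono: "n \<le> k \<Longrightarrow> ideal_power R m k \<subseteq> ideal_power R m n"
proof (induction rule: dec_induct)
  case (step k)
  then show ?case
    using R.ideal_prod_inter[OF ideal_ideal_power ideal_m, of k] unfolding ideal_power_Suc by blast
qed simp

lemma ideal_power_finite_generators:
  obtains F where "finite F" "F \<subseteq> carrier R" "F \<subseteq> ideal_power R m n" "ideal_power R m n = Idl F"
proof -
  obtain F where F: "F \<subseteq> carrier R" "finite F" "ideal_power R m n = Idl F"
    using R.finetely_gen[OF ideal_ideal_power, of n] by (elim exE conjE)
  moreover have "F \<subseteq> ideal_power R m n" unfolding F(3) by (rule R.genideal_self[OF F(1)])
  ultimately show thesis by (intro that)
qed

lemma completion_carrierD:
  assumes s: "s \<in> carrier (completion R m)"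
  shows "\<exists>r. r \<in> s n" and "s n \<subseteq> carrier R"
    and "\<lbrakk>r \<in> s n; r' \<in> s n\<rbrakk> \<Longrightarrow> r \<ominus> r' \<in> ideal_power R m n"
    and "n \<le> k \<Longrightarrow> s k \<subseteq> s n"
proof -
  interpret I: ideal "ideal_power R m n" R by (rule ideal_ideal_power)
  have "s n \<in> a_rcosets (ideal_power R m n)"
    using s by (simp add: completion_def FactRing_def)
  then obtain x where x: "x \<in> carrier R" "s n = ideal_power R m n +> x"
    by (auto simp: A_RCOSETS_def')
  show "\<exists>r. r \<in> s n" using I.a_rcos_self[OF x(1)] x(2) by auto
  show sub: "s n \<subseteq> carrier R" using R.a_r_coset_subset_G[OF ideal_power_subset x(1)] x(2) by simp
  show "r \<ominus> r' \<in> ideal_power R m n" if "r \<in> s n" "r' \<in> s n"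
    using that sub x I.a_rcos_module_minus[OF R.ring_axioms, of r' r] I.a_repr_independence'[of r' x]
    by auto
  show "s k \<subseteq> s n" if "n \<le> k"
    using that
  proof (induction rule: dec_induct)
    case (step k)
    then show ?case using s by (auto simp: completion_def)
  qed simp
qed

lemma completion_of_sequence:
  assumes r: "\<And>n. r n \<in> carrier R" "\<And>n. r (Suc n) \<ominus> r n \<in> ideal_power R m n"
  shows "(\<lambda>n. ideal_power R m n +> r n) \<in> carrier (completion R m)"
proof -
  have "ideal_power R m (Suc n) +> r (Suc n) \<subseteq> ideal_power R m n +> r n" for n
  proof -
    interpret I: ideal "ideal_power R m n" R by (rule ideal_ideal_power)
    have "r (Suc n) \<in> ideal_power R m n +> r n"
      using I.a_rcos_module_minus[OF R.ring_axioms r(1)] r by simp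
    then have "ideal_power R m n +> r n = ideal_power R m n +> r (Suc n)"
      by (rule I.a_repr_independence'[OF _ r(1)])
    then show ?thesis
      using ideal_power_antimono[of n "Suc n"] by (auto simp: a_r_coset_def')
  qed
  then show ?thesis
    using r(1) by (auto simp: completion_def FactRing_def A_RCOSETS_def')
qed

end

section \<open>Endomorphisms of the injective hull of the residue field\<close>

locale noetherian_local_ring_hull = noetherian_local_ring R m
  for R :: "('a, 'r) ring_scheme" (structure) and m :: "'a set" +
  fixes E :: "('a, 'e, 'z) module_scheme"
  assumes hull: "injective_hull TYPE('a) R (quot_module R (regular_module R) m) E"
begin

lemma injective_E: "injective_module TYPE('a) R E"
  using hull by (simp add: injective_hull_def)

sublocale E: module R E using injective_E by (simp add: injective_module_def)

lemma ideal_is_regular_submodule: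
  assumes "ideal I R"
  shows "submodule I R (regular_module R)"
proof -
  interpret I: ideal I R by fact
  have "subgroup I (add_monoid (regular_module R))"
    using I.a_subgroup by (simp add: regular_module_def subgroup_def m_inv_def)
  then show ?thesis
    using I.I_l_closed by (auto simp: submodule_def submodule_axioms_def regular_module_def)
qed

text \<open>
  The elements of \<open>E\<close> annihilated by \<open>m\<close> form the copy of the residue field: a further one would
  generate a submodule that meets this copy trivially, against essentiality.
\<close>

lemma socle_generator:
  "\<exists>e\<in>carrier E. e \<noteq> \<zero>\<^bsub>E\<^esub> \<and> (\<forall>a\<in>m. a \<odot>\<^bsub>E\<^esub> e = \<zero>\<^bsub>E\<^esub>) \<and>
     (\<forall>y\<in>E.annihilated_by m. \<exists>r\<in>carrier R. y = r \<odot>\<^bsub>E\<^esub> e)"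
proof -
  let ?Rm = "regular_module R" and ?K = "quot_module R (regular_module R) m"
  interpret Rm: module R ?Rm by (rule regular_module_is_module) (rule R.is_cring)
  have sub: "submodule m R ?Rm" by (rule ideal_is_regular_submodule[OF ideal_m])
  obtain i where i: "i \<in> lin_maps R ?K E" "inj_on i (carrier ?K)"
    and ess: "\<And>U. \<lbrakk>submodule U R E; U \<inter> i ` carrier ?K = {\<zero>\<^bsub>E\<^esub>}\<rbrakk> \<Longrightarrow> U = {\<zero>\<^bsub>E\<^esub>}"
    using hull unfolding injective_hull_def by blast
  define q where "q r = m +>\<^bsub>?Rm\<^esub> r" for r
  define e where "e = i (q \<one>)"
  have K: "carrier ?K = q ` carrier R"
    unfolding Rm.quot_module_carrier q_def by (simp add: regular_module_def)
  have qK: "q r \<in> carrier ?K" if "r \<in> carrier R" for r using that K by auto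
  have e: "e \<in> carrier E" unfolding e_def by (intro lin_mapsD(1)[OF i(1)] qK) simp
  have iq: "i (q r) = r \<odot>\<^bsub>E\<^esub> e" if "r \<in> carrier R" for r
    using lin_mapsD(3)[OF i(1) that qK[OF R.one_closed]] that
      Rm.quot_module_smult[OF sub that, of "\<one>"]
    by (simp add: e_def q_def) (simp add: regular_module_def)
  have img: "i ` carrier ?K = (\<lambda>r. r \<odot>\<^bsub>E\<^esub> e) ` carrier R"
    unfolding K image_image using iq by auto
  have qm: "q a = m \<longleftrightarrow> a \<in> m" if "a \<in> carrier R" for a
    using Rm.coset_eq_submodule_iff[OF sub, of a] that by (simp add: q_def regular_module_def)
  have q0: "q \<zero> = m" using qm ideal_m by (simp add: additive_subgroup.zero_closed ideal.axioms(1))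
  have me: "a \<odot>\<^bsub>E\<^esub> e = \<zero>\<^bsub>E\<^esub>" if "a \<in> m" for a
    using iq[of a] iq[of \<zero>] q0 qm[of a] that m_subset e by auto
  have ne: "e \<noteq> \<zero>\<^bsub>E\<^esub>"
  proof
    assume "e = \<zero>\<^bsub>E\<^esub>"
    then have "i (q \<one>) = i (q \<zero>)" using iq[of \<zero>] e by (simp add: e_def)
    then have "q \<one> = q \<zero>" by (rule inj_onD[OF i(2)]) (auto intro: qK)
    then show False using q0 qm[of \<one>] one_notin_m by simp
  qed
  have gen: "\<exists>r\<in>carrier R. y = r \<odot>\<^bsub>E\<^esub> e" if y: "y \<in> E.annihilated_by m" for y
  proof (rule ccontr)
    assume n: "\<not> (\<exists>r\<in>carrier R. y = r \<odot>\<^bsub>E\<^esub> e)"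
    have yc: "y \<in> carrier E" and my: "\<And>a. a \<in> m \<Longrightarrow> a \<odot>\<^bsub>E\<^esub> y = \<zero>\<^bsub>E\<^esub>"
      using y by (auto simp: E.annihilated_by_def)
    let ?U = "(\<lambda>r. r \<odot>\<^bsub>E\<^esub> y) ` carrier R"
    have U: "submodule ?U R E" by (rule E.submodule_cyclic[OF yc])
    have "u = \<zero>\<^bsub>E\<^esub>" if u: "u \<in> ?U" "u \<in> (\<lambda>r. r \<odot>\<^bsub>E\<^esub> e) ` carrier R" for u
    proof -
      obtain r r' where r: "r \<in> carrier R" "r' \<in> carrier R" "u = r \<odot>\<^bsub>E\<^esub> y" "u = r' \<odot>\<^bsub>E\<^esub> e"
        using u by auto
      have "r \<in> m"
      proof (rule ccontr)
        assume "r \<notin> m"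
        then obtain s where s: "s \<in> carrier R" "s \<otimes> r = \<one>" using unit_if_notin_m r(1) by blast
        have "y = s \<odot>\<^bsub>E\<^esub> (r \<odot>\<^bsub>E\<^esub> y)" using s r(1) yc by (simp add: E.smult_assoc1[symmetric])
        also have "\<dots> = (s \<otimes> r') \<odot>\<^bsub>E\<^esub> e" using r s e by (simp add: E.smult_assoc1)
        finally show False using n s(1) r(2) by auto
      qed
      then show ?thesis using my r(3) by simp
    qed
    moreover have "\<zero>\<^bsub>E\<^esub> \<in> ?U" "\<zero>\<^bsub>E\<^esub> \<in> (\<lambda>r. r \<odot>\<^bsub>E\<^esub> e) ` carrier R"
      using e yc by (auto intro: image_eqI[of _ _ \<zero>])
    ultimately have "?U \<inter> i ` carrier ?K = {\<zero>\<^bsub>E\<^esub>}" unfolding img by blast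
    then have "?U = {\<zero>\<^bsub>E\<^esub>}" by (rule ess[OF U])
    moreover have "y \<in> ?U" using yc by (intro image_eqI[of _ _ \<one>]) auto
    ultimately have "y = \<zero> \<odot>\<^bsub>E\<^esub> e" using e by auto
    then show False using n by blast
  qed
  show ?thesis using e ne me gen by (intro bexI[of _ e] conjI ballI)
qed

lemma endomorphism_on_socle:
  assumes \<phi>: "\<phi> \<in> lin_maps R E E"
  shows "\<exists>c\<in>carrier R. \<forall>y\<in>E.annihilated_by m. \<phi> y = c \<odot>\<^bsub>E\<^esub> y"
proof -
  from socle_generator obtain e where e: "e \<in> carrier E" "\<forall>a\<in>m. a \<odot>\<^bsub>E\<^esub> e = \<zero>\<^bsub>E\<^esub>"
    and gen: "\<forall>y\<in>E.annihilated_by m. \<exists>r\<in>carrier R. y = r \<odot>\<^bsub>E\<^esub> e"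
    by (elim bexE conjE)
  have "a \<odot>\<^bsub>E\<^esub> \<phi> e = \<zero>\<^bsub>E\<^esub>" if "a \<in> m" for a
    using lin_mapsD(3)[OF \<phi> subsetD[OF m_subset that] e(1)] bspec[OF e(2) that]
      lin_maps_zero[OF E.module_axioms E.module_axioms \<phi>] by simp
  then have "\<phi> e \<in> E.annihilated_by m"
    using lin_mapsD(1)[OF \<phi>] e by (simp add: E.annihilated_by_def)
  then obtain c where c: "c \<in> carrier R" "\<phi> e = c \<odot>\<^bsub>E\<^esub> e" using gen by auto
  have "\<phi> y = c \<odot>\<^bsub>E\<^esub> y" if y: "y \<in> E.annihilated_by m" for y
  proof -
    obtain r where r: "r \<in> carrier R" "y = r \<odot>\<^bsub>E\<^esub> e" using bspec[OF gen y] by auto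
    show ?thesis
      using lin_mapsD(3)[OF \<phi> r(1) e(1)] r(2) c E.smult_left_commute[OF r(1) c(1) e(1)] by simp
  qed
  with c(1) show ?thesis by blast
qed

lemma lin_maps_smult:
  assumes r: "r \<in> carrier R"
  shows "(\<lambda>y\<in>carrier E. r \<odot>\<^bsub>E\<^esub> y) \<in> lin_maps R E E"
proof (rule lin_mapsI)
  fix s y assume "s \<in> carrier R" "y \<in> carrier E"
  then show "(\<lambda>y\<in>carrier E. r \<odot>\<^bsub>E\<^esub> y) (s \<odot>\<^bsub>E\<^esub> y) = s \<odot>\<^bsub>E\<^esub> (\<lambda>y\<in>carrier E. r \<odot>\<^bsub>E\<^esub> y) y"
    using E.smult_left_commute[OF r] by simp
qed (simp_all add: r E.smult_r_distr)

text \<open>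
  The difference \<open>\<phi> - r\<close> vanishes where all generators
  \<open>a\<close> of \<open>m\<^sup>n\<close> do, hence is a sum of maps \<open>\<psi> \<circ> a\<close>. As \<open>a y\<close> lies in the socle when \<open>m\<^sup>n\<^sup>+\<^sup>1 y = 0\<close>,
  each \<open>\<psi>\<close> may be replaced by a ring element.
\<close>

lemma endomorphism_step:
  assumes \<phi>: "\<phi> \<in> lin_maps R E E" and r: "r \<in> carrier R"
    and eq: "\<And>y. y \<in> E.annihilated_by (ideal_power R m n) \<Longrightarrow> \<phi> y = r \<odot>\<^bsub>E\<^esub> y"
  shows "\<exists>r'\<in>carrier R. r' \<ominus> r \<in> ideal_power R m n \<and>
           (\<forall>y\<in>E.annihilated_by (ideal_power R m (Suc n)). \<phi> y = r' \<odot>\<^bsub>E\<^esub> y)"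
proof -
  interpret I: ideal "ideal_power R m n" R by (rule ideal_ideal_power)
  let ?K = "E.annihilated_by (ideal_power R m (Suc n))"
  define mul where "mul a = (\<lambda>y\<in>carrier E. a \<odot>\<^bsub>E\<^esub> y)" for a
  define f where "f = (\<lambda>y\<in>carrier E. \<phi> y \<oplus>\<^bsub>E\<^esub> (\<ominus>\<^bsub>E\<^esub> (r \<odot>\<^bsub>E\<^esub> y)))"
  obtain F where F: "finite F" "F \<subseteq> carrier R" "F \<subseteq> ideal_power R m n" "ideal_power R m n = Idl F"
    by (rule ideal_power_finite_generators)
  note \<phi>' = lin_mapsD[OF \<phi>]
  have Kc: "y \<in> carrier E" if "y \<in> ?K" for y using that by (simp add: E.annihilated_by_def)
  have f: "f \<in> lin_maps R E E"
  proof (rule lin_mapsI)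
    fix y assume y: "y \<in> carrier E"
    show "f y \<in> carrier E" using y \<phi>' r by (simp add: f_def)
    show "f (y \<oplus>\<^bsub>E\<^esub> y') = f y \<oplus>\<^bsub>E\<^esub> f y'" if "y' \<in> carrier E" for y'
      using that y \<phi>' r by (simp add: f_def E.smult_r_distr E.M.minus_add E.add.m_ac)
    show "f (s \<odot>\<^bsub>E\<^esub> y) = s \<odot>\<^bsub>E\<^esub> f y" if "s \<in> carrier R" for s
      using that y \<phi>' r
      by (simp add: f_def E.smult_r_distr E.smult_r_minus E.smult_left_commute[OF r that])
  qed (simp add: f_def)
  have "\<exists>h\<in>mul ` ideal_power R m n. \<forall>y\<in>?K. f y = h y"
  proof (rule vanishing_on_common_kernel[OF injective_E E.module_axioms _ _ _ f, where S = "mul ` F"])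
    show "mul ` ideal_power R m n \<subseteq> lin_maps R E E" "mul ` F \<subseteq> lin_maps R E E"
      using lin_maps_smult ideal_power_subset F(2) by (auto simp: mul_def)
    show "(\<lambda>y\<in>carrier E. \<zero>\<^bsub>E\<^esub>) \<in> mul ` ideal_power R m n"
      by (intro image_eqI[of _ _ \<zero>]) (auto simp: mul_def)
    show "(\<lambda>y\<in>carrier E. h y \<oplus>\<^bsub>E\<^esub> h' y) \<in> mul ` ideal_power R m n"
      if hh: "h \<in> mul ` ideal_power R m n" "h' \<in> mul ` ideal_power R m n" for h h'
    proof -
      obtain a a' where a: "a \<in> ideal_power R m n" "a' \<in> ideal_power R m n" "h = mul a" "h' = mul a'"
        using hh by auto
      then have "a \<in> carrier R" "a' \<in> carrier R" using ideal_power_subset by auto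
      then show ?thesis
        using a by (intro image_eqI[of _ _ "a \<oplus> a'"]) (auto simp: mul_def E.smult_l_distr)
    qed
    show "submodule ?K R E" by (rule E.submodule_annihilated_by[OF ideal_power_subset])
    show "\<exists>h\<in>mul ` ideal_power R m n. \<forall>y\<in>?K. h y = \<psi> (g y)"
      if "g \<in> mul ` F" and \<psi>: "\<psi> \<in> lin_maps R E E" for g \<psi>
    proof -
      obtain a where a: "a \<in> F" "g = mul a" using \<open>g \<in> mul ` F\<close> by auto
      have ac: "a \<in> carrier R" "a \<in> ideal_power R m n" using a F by auto
      from endomorphism_on_socle[OF \<psi>] obtain c where c: "c \<in> carrier R" "\<forall>y\<in>E.annihilated_by m. \<psi> y = c \<odot>\<^bsub>E\<^esub> y"
        by (elim bexE)
      have "mul (c \<otimes> a) y = \<psi> (g y)" if y: "y \<in> ?K" for y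
      proof -
        have "b \<odot>\<^bsub>E\<^esub> (a \<odot>\<^bsub>E\<^esub> y) = \<zero>\<^bsub>E\<^esub>" if "b \<in> m" for b
        proof -
          have "a \<otimes> b \<in> ideal_power R m (Suc n)"
            unfolding ideal_power_Suc using ac that by (intro ideal_prod.prod)
          then have "(a \<otimes> b) \<odot>\<^bsub>E\<^esub> y = \<zero>\<^bsub>E\<^esub>" using y by (simp add: E.annihilated_by_def)
          moreover have "b \<in> carrier R" using that m_subset by blast
          ultimately show ?thesis
            using E.smult_left_commute[OF _ ac(1) Kc[OF y], of b] E.smult_assoc1[OF ac(1) _ Kc[OF y], of b]
            by simp
        qed
        then have "a \<odot>\<^bsub>E\<^esub> y \<in> E.annihilated_by m"
          using ac Kc[OF y] by (simp add: E.annihilated_by_def)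
        then show ?thesis using c ac Kc[OF y] by (simp add: a(2) mul_def E.smult_assoc1)
      qed
      moreover have "c \<otimes> a \<in> ideal_power R m n" using c ac by (simp add: I.I_l_closed)
      ultimately show ?thesis by blast
    qed
    show "f y = \<zero>\<^bsub>E\<^esub>" if y: "y \<in> ?K" and van: "\<forall>g\<in>mul ` F. g y = \<zero>\<^bsub>E\<^esub>" for y
    proof -
      have "y \<in> E.annihilated_by F" using van Kc[OF y] by (simp add: mul_def E.annihilated_by_def)
      then have "y \<in> E.annihilated_by (ideal_power R m n)"
        using E.annihilated_by_genideal[OF F(2)] F(4) by simp
      then show ?thesis using eq[of y] Kc[OF y] r by (simp add: f_def E.r_neg)
    qed
  qed (use F(1) in auto)
  then obtain a where a: "a \<in> ideal_power R m n" "\<And>y. y \<in> ?K \<Longrightarrow> f y = mul a y" by auto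
  have ac: "a \<in> carrier R" using a(1) ideal_power_subset by auto
  have "\<phi> y = (a \<oplus> r) \<odot>\<^bsub>E\<^esub> y" if y: "y \<in> ?K" for y
  proof -
    have c: "y \<in> carrier E" "\<phi> y \<in> carrier E" using Kc[OF y] \<phi>' by auto
    have "\<phi> y \<oplus>\<^bsub>E\<^esub> (\<ominus>\<^bsub>E\<^esub> (r \<odot>\<^bsub>E\<^esub> y)) = a \<odot>\<^bsub>E\<^esub> y" using a(2)[OF y] c by (simp add: f_def mul_def)
    then have "a \<odot>\<^bsub>E\<^esub> y \<oplus>\<^bsub>E\<^esub> r \<odot>\<^bsub>E\<^esub> y = \<phi> y \<oplus>\<^bsub>E\<^esub> ((\<ominus>\<^bsub>E\<^esub> (r \<odot>\<^bsub>E\<^esub> y)) \<oplus>\<^bsub>E\<^esub> r \<odot>\<^bsub>E\<^esub> y)"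
      using c r by (simp add: E.M.a_assoc[symmetric])
    then show ?thesis using c r ac by (simp add: E.smult_l_distr E.l_neg)
  qed
  moreover have "(a \<oplus> r) \<ominus> r = a" using ac r by (simp add: R.minus_eq R.a_assoc R.r_neg)
  ultimately show ?thesis using a(1) ac r by (intro bexI[of _ "a \<oplus> r"]) auto
qed

text \<open>
  Matlis's theorem that endomorphisms of \<open>E\<close> are scalars from the completion, on the elements of \<open>E\<close>
  that are killed by a power of \<open>m\<close>. The ring elements found step by step differ by elements of
  \<open>m\<^sup>n\<close>, so they are the components of one element of the completion.
\<close>

theorem endomorphism_is_completion_scalar:
  assumes \<phi>: "\<phi> \<in> lin_maps R E E"
  shows "\<exists>s\<in>carrier (completion R m).
    \<forall>n. \<forall>y\<in>E.annihilated_by (ideal_power R m n). \<forall>r\<in>s n. \<phi> y = r \<odot>\<^bsub>E\<^esub> y"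
proof -
  let ?P = "\<lambda>n r. r \<in> carrier R \<and>
    (\<forall>y\<in>E.annihilated_by (ideal_power R m n). \<phi> y = r \<odot>\<^bsub>E\<^esub> y)"
  have "\<exists>r. \<forall>n. ?P n (r n) \<and> r (Suc n) \<ominus> r n \<in> ideal_power R m n"
  proof (rule dependent_nat_choice[where P = ?P and Q = "\<lambda>n r r'. r' \<ominus> r \<in> ideal_power R m n"])
    have "\<phi> y = \<zero> \<odot>\<^bsub>E\<^esub> y" if y: "y \<in> E.annihilated_by (carrier R)" for y
    proof -
      have yc: "y \<in> carrier E" and ann: "\<forall>a\<in>carrier R. a \<odot>\<^bsub>E\<^esub> y = \<zero>\<^bsub>E\<^esub>" using y by (simp_all add: E.annihilated_by_def)
      have "y = \<zero>\<^bsub>E\<^esub>" using bspec[OF ann R.one_closed] yc by simp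
      then show ?thesis using lin_maps_zero[OF E.module_axioms E.module_axioms \<phi>] by simp
    qed
    then show "\<exists>r. ?P 0 r" unfolding ideal_power_0 by (intro exI[of _ \<zero>]) simp
    show "\<exists>r'. ?P (Suc n) r' \<and> r' \<ominus> r \<in> ideal_power R m n" if Pn: "?P n r" for n r
    proof -
      have "\<exists>r'\<in>carrier R. r' \<ominus> r \<in> ideal_power R m n \<and>
          (\<forall>y\<in>E.annihilated_by (ideal_power R m (Suc n)). \<phi> y = r' \<odot>\<^bsub>E\<^esub> y)"
        by (rule endomorphism_step[OF \<phi> conjunct1[OF Pn]]) (rule bspec[OF conjunct2[OF Pn]])
      then obtain r' where "r' \<in> carrier R" "r' \<ominus> r \<in> ideal_power R m n"
        "\<forall>y\<in>E.annihilated_by (ideal_power R m (Suc n)). \<phi> y = r' \<odot>\<^bsub>E\<^esub> y"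
        by (elim bexE conjE)
      then show ?thesis by (intro exI[of _ r'] conjI)
    qed
  qed
  then obtain r where P: "\<forall>n. ?P n (r n) \<and> r (Suc n) \<ominus> r n \<in> ideal_power R m n" by (elim exE)
  then have r: "\<And>n. r n \<in> carrier R"
    "\<And>n y. y \<in> E.annihilated_by (ideal_power R m n) \<Longrightarrow> \<phi> y = r n \<odot>\<^bsub>E\<^esub> y"
    "\<And>n. r (Suc n) \<ominus> r n \<in> ideal_power R m n"
    by (simp_all only: simp_thms ball_simps)
  show ?thesis
  proof (intro bexI[OF _ completion_of_sequence[OF r(1,3)]] allI ballI)
    fix n y x assume y: "y \<in> E.annihilated_by (ideal_power R m n)" and "x \<in> ideal_power R m n +> r n"
    then obtain b where b: "b \<in> ideal_power R m n" "x = b \<oplus> r n"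
      unfolding a_r_coset_def' by blast
    have bc: "b \<in> carrier R" using b(1) ideal_power_subset by blast
    have yc: "y \<in> carrier E" "b \<odot>\<^bsub>E\<^esub> y = \<zero>\<^bsub>E\<^esub>"
      using b(1) y by (simp_all add: E.annihilated_by_def)
    have "x \<odot>\<^bsub>E\<^esub> y = b \<odot>\<^bsub>E\<^esub> y \<oplus>\<^bsub>E\<^esub> r n \<odot>\<^bsub>E\<^esub> y"
      unfolding b(2) by (rule E.smult_l_distr[OF bc r(1) yc(1)])
    also have "\<dots> = r n \<odot>\<^bsub>E\<^esub> y" unfolding yc(2) by (rule E.M.l_zero) (rule E.smult_closed[OF r(1) yc(1)])
    finally show "\<phi> y = x \<odot>\<^bsub>E\<^esub> y" using r(2)[OF y] by simp
  qed
qed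

end


section \<open>Artinian modules\<close>

lemma artinian_module_minimal:
  assumes art: "artinian_module R M" and P: "U \<in> P" "\<And>U. U \<in> P \<Longrightarrow> submodule U R M"
  shows "\<exists>U\<in>P. \<forall>V\<in>P. V \<subseteq> U \<longrightarrow> V = U"
proof (rule ccontr)
  assume "\<not> (\<exists>U\<in>P. \<forall>V\<in>P. V \<subseteq> U \<longrightarrow> V = U)"
  then have ex: "\<exists>V. V \<in> P \<and> V \<subset> U" if "U \<in> P" for U using that by blast
  have "\<exists>H. \<forall>n. H n \<in> P \<and> H (Suc n) \<subset> H n"
    by (rule dependent_nat_choice[where P = "\<lambda>_ U. U \<in> P" and Q = "\<lambda>_ U V. V \<subset> U"])
      (use P(1) ex in auto)
  then obtain H where H: "\<And>n. H n \<in> P" "\<And>n. H (Suc n) \<subset> H n" by blast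
  then obtain n where "\<forall>k\<ge>n. H k = H n"
    using art P(2) unfolding artinian_module_def by (meson psubset_imp_subset)
  then have "H (Suc n) = H n" using le_SucI[of n n] by blast
  then show False using H(2)[of n] by simp
qed

locale artinian_over_local = noetherian_local_ring R m
  for R :: "('a, 'r) ring_scheme" (structure) and m :: "'a set" +
  fixes B :: "('a, 'b, 'y) module_scheme"
  assumes artinian: "artinian_module R B"
begin

sublocale B: module R B using artinian by (simp add: artinian_module_def)

lemma annihilated_by_power_mono:
  "n \<le> k \<Longrightarrow> B.annihilated_by (ideal_power R m n) \<subseteq> B.annihilated_by (ideal_power R m k)"
  using ideal_power_antimono[of n k] unfolding B.annihilated_by_def by blast

text \<open>
  As \<open>m\<close> is finitely generated, a single \<open>m\<^sup>N\<close> kills \<open>a x\<close> for all generators \<open>a\<close> of \<open>m\<close>. Hence all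
  of \<open>m\<close> kills \<open>m\<^sup>N x\<close>.
\<close>

lemma torsion_if_multiples_torsion:
  assumes x: "x \<in> carrier B"
    and mx: "\<And>a. a \<in> m \<Longrightarrow> \<exists>n. a \<odot>\<^bsub>B\<^esub> x \<in> B.annihilated_by (ideal_power R m n)"
  shows "\<exists>n. x \<in> B.annihilated_by (ideal_power R m n)"
proof -
  obtain F where F: "F \<subseteq> carrier R" "finite F" "m = Idl F"
    using R.finetely_gen[OF ideal_m] by (elim exE conjE)
  have Fm: "F \<subseteq> m" unfolding F(3) by (rule R.genideal_self[OF F(1)])
  have "\<exists>N. \<forall>a\<in>G. a \<odot>\<^bsub>B\<^esub> x \<in> B.annihilated_by (ideal_power R m N)" if "finite G" "G \<subseteq> m" for G
    using that
  proof (induction G rule: finite_induct)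
    case (insert a G)
    obtain N where N: "\<forall>a\<in>G. a \<odot>\<^bsub>B\<^esub> x \<in> B.annihilated_by (ideal_power R m N)"
      using insert by auto
    obtain n where n: "a \<odot>\<^bsub>B\<^esub> x \<in> B.annihilated_by (ideal_power R m n)" using mx[of a] insert by auto
    show ?case
      using N n annihilated_by_power_mono[of N "max N n"] annihilated_by_power_mono[of n "max N n"]
      by (intro exI[of _ "max N n"]) auto
  qed auto
  from this[OF F(2) Fm] obtain N
    where N: "\<forall>a\<in>F. a \<odot>\<^bsub>B\<^esub> x \<in> B.annihilated_by (ideal_power R m N)" by (elim exE)
  have "c \<odot>\<^bsub>B\<^esub> x = \<zero>\<^bsub>B\<^esub>" if "c \<in> ideal_prod R (ideal_power R m N) m" for c
    using that
  proof (induction c rule: ideal_prod.induct)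
    case (prod i j)
    have c: "i \<in> carrier R" "j \<in> carrier R" using prod ideal_power_subset m_subset by auto
    have "a \<odot>\<^bsub>B\<^esub> (i \<odot>\<^bsub>B\<^esub> x) = \<zero>\<^bsub>B\<^esub>" if a: "a \<in> F" for a
    proof -
      have "a \<odot>\<^bsub>B\<^esub> (i \<odot>\<^bsub>B\<^esub> x) = i \<odot>\<^bsub>B\<^esub> (a \<odot>\<^bsub>B\<^esub> x)"
        by (rule B.smult_left_commute) (use a F(1) c x in auto)
      also have "\<dots> = \<zero>\<^bsub>B\<^esub>" using N a prod(1) by (simp add: B.annihilated_by_def)
      finally show ?thesis .
    qed
    then have "i \<odot>\<^bsub>B\<^esub> x \<in> B.annihilated_by F" using c x by (simp add: B.annihilated_by_def)
    then have "i \<odot>\<^bsub>B\<^esub> x \<in> B.annihilated_by m" using B.annihilated_by_genideal[OF F(1)] F(3) by simp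
    then have "j \<odot>\<^bsub>B\<^esub> (i \<odot>\<^bsub>B\<^esub> x) = \<zero>\<^bsub>B\<^esub>" using prod(2) by (simp add: B.annihilated_by_def)
    then show ?case using B.smult_left_commute[OF c x] B.smult_assoc1[OF c x] by simp
  next
    case (sum s1 s2)
    have "s1 \<in> carrier R" "s2 \<in> carrier R"
      using sum.hyps R.ideal_prod_in_carrier[OF ideal_ideal_power ideal_m] by auto
    then show ?case using sum.IH x by (simp add: B.smult_l_distr)
  qed
  then have "x \<in> B.annihilated_by (ideal_power R m (Suc N))"
    unfolding ideal_power_Suc B.annihilated_by_def using x by blast
  then show ?thesis by blast
qed

text \<open>
  If this fails, choose a submodule \<open>V\<close> minimal among those with an element \<open>x\<close> not killed by any power
  of \<open>m\<close>. For \<open>a \<in> m\<close> the submodule \<open>R a x\<close> of \<open>V\<close> is not all of \<open>V\<close>, since \<open>x = r a x\<close> would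
  give \<open>x = 0\<close>. So \<open>m x\<close>, and with it \<open>x\<close>, is killed by a power of \<open>m\<close>.
\<close>

theorem torsion:
  assumes "x \<in> carrier B"
  shows "\<exists>n. x \<in> B.annihilated_by (ideal_power R m n)"
proof (rule ccontr)
  assume n: "\<not> (\<exists>n. x \<in> B.annihilated_by (ideal_power R m n))"
  define T where "T = (\<Union>n. B.annihilated_by (ideal_power R m n))"
  define P where "P = {V. submodule V R B \<and> \<not> V \<subseteq> T}"
  have "\<exists>V\<in>P. \<forall>W\<in>P. W \<subseteq> V \<longrightarrow> W = V"
    by (rule artinian_module_minimal[OF artinian, of "carrier B"])
      (use assms n B.carrier_is_submodule in \<open>auto simp: P_def T_def\<close>)
  then obtain V where VP: "V \<in> P" "\<forall>W\<in>P. W \<subseteq> V \<longrightarrow> W = V" by (elim bexE)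
  have V: "submodule V R B" "\<not> V \<subseteq> T" using VP(1) by (simp_all add: P_def)
  obtain y where y: "y \<in> V" "y \<notin> T" using V(2) by blast
  have yc: "y \<in> carrier B" using B.submoduleE(1)[OF V(1)] y by blast
  have T: "\<exists>n. z \<in> B.annihilated_by (ideal_power R m n)" if "z \<in> T" for z using that by (auto simp: T_def)
  have "a \<odot>\<^bsub>B\<^esub> y \<in> T" if a: "a \<in> m" for a
  proof (rule ccontr)
    assume nT: "a \<odot>\<^bsub>B\<^esub> y \<notin> T"
    have ac: "a \<in> carrier R" using a m_subset by blast
    let ?W = "(\<lambda>r. r \<odot>\<^bsub>B\<^esub> (a \<odot>\<^bsub>B\<^esub> y)) ` carrier R"
    have ay: "a \<odot>\<^bsub>B\<^esub> y \<in> carrier B" using ac yc by simp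
    have "?W = V"
    proof (rule VP(2)[rule_format])
      have "a \<odot>\<^bsub>B\<^esub> y \<in> ?W" using ay by (intro image_eqI[of _ _ \<one>]) auto
      then show "?W \<in> P" unfolding P_def using nT B.submodule_cyclic[OF ay] by blast
      show "?W \<subseteq> V" using B.submoduleE(4)[OF V(1)] y(1) ac by auto
    qed
    then obtain r where r: "r \<in> carrier R" "y = r \<odot>\<^bsub>B\<^esub> (a \<odot>\<^bsub>B\<^esub> y)" using y(1) by blast
    have ra: "r \<otimes> a \<in> m" using ideal.I_l_closed[OF ideal_m a r(1)] .
    have rac: "r \<otimes> a \<in> carrier R" using r ac by simp
    have "\<one> \<ominus> r \<otimes> a \<notin> m"
    proof
      assume "\<one> \<ominus> r \<otimes> a \<in> m"
      then have "(\<one> \<ominus> r \<otimes> a) \<oplus> r \<otimes> a \<in> m"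
        using ra additive_subgroup.a_closed[OF ideal.axioms(1)[OF ideal_m]] by blast
      then show False using one_notin_m rac by (simp add: R.minus_eq R.a_assoc R.l_neg)
    qed
    then obtain s where s: "s \<in> carrier R" "s \<otimes> (\<one> \<ominus> r \<otimes> a) = \<one>"
      using unit_if_notin_m[of "\<one> \<ominus> r \<otimes> a"] rac by auto
    have ray: "(r \<otimes> a) \<odot>\<^bsub>B\<^esub> y = y" using r(2) B.smult_assoc1[OF r(1) ac yc] by simp
    have "(\<one> \<ominus> r \<otimes> a) \<odot>\<^bsub>B\<^esub> y = \<zero>\<^bsub>B\<^esub>"
      using rac yc ray by (simp add: R.minus_eq B.smult_l_distr B.smult_l_minus B.r_neg)
    then have "s \<odot>\<^bsub>B\<^esub> ((\<one> \<ominus> r \<otimes> a) \<odot>\<^bsub>B\<^esub> y) = \<zero>\<^bsub>B\<^esub>" using s(1) by simp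
    then have "y = \<zero>\<^bsub>B\<^esub>"
      using B.smult_assoc1[OF s(1) _ yc, of "\<one> \<ominus> r \<otimes> a"] s rac yc by simp
    then have "y \<in> B.annihilated_by (ideal_power R m 0)"
      unfolding ideal_power_0 by (simp add: B.annihilated_by_def)
    then have "y \<in> T" unfolding T_def by (rule UN_I[OF UNIV_I])
    then show False using y(2) by simp
  qed
  then have "\<exists>n. y \<in> B.annihilated_by (ideal_power R m n)"
    by (intro torsion_if_multiples_torsion[OF yc] T)
  then show False using y(2) unfolding T_def by blast
qed

lemma torsion2:
  assumes "x \<in> carrier B" "y \<in> carrier B"
  obtains n where "x \<in> B.annihilated_by (ideal_power R m n)" "y \<in> B.annihilated_by (ideal_power R m n)"
proof -
  obtain n k where "x \<in> B.annihilated_by (ideal_power R m n)" "y \<in> B.annihilated_by (ideal_power R m k)"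
    using torsion[OF assms(1)] torsion[OF assms(2)] by (elim exE)
  then show thesis
    using annihilated_by_power_mono[of n "max n k"] annihilated_by_power_mono[of k "max n k"]
    by (intro that[of "max n k"]) auto
qed

text \<open>
  Any two admissible representatives of \<open>s\<close> differ by an element of the power of \<open>m\<close> with the smaller
  exponent, which kills \<open>x\<close>, so the description in the definition is unambiguous.
\<close>

lemma completed_smult:
  assumes s: "s \<in> carrier (completion R m)"
    and x: "x \<in> B.annihilated_by (ideal_power R m n)" and r: "r \<in> s n"
  shows "s \<odot>\<^bsub>completed_module R m B\<^esub> x = r \<odot>\<^bsub>B\<^esub> x"
proof -
  have xc: "x \<in> carrier B" using x by (simp add: B.annihilated_by_def)
  have aux: "r' \<odot>\<^bsub>B\<^esub> x = r \<odot>\<^bsub>B\<^esub> x"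
    if "n \<le> k" "r \<in> s n" "r' \<in> s k" "x \<in> B.annihilated_by (ideal_power R m n)" for n k r r'
  proof -
    have r': "r' \<in> s n" using completion_carrierD(4)[OF s that(1)] that(3) by blast
    have c: "r \<in> carrier R" "r' \<in> carrier R"
      using completion_carrierD(2)[OF s, of n] that(2) r' by auto
    have "r' \<ominus> r \<in> ideal_power R m n" by (rule completion_carrierD(3)[OF s r' that(2)])
    then have "(r' \<ominus> r) \<odot>\<^bsub>B\<^esub> x = \<zero>\<^bsub>B\<^esub>" using that(4) by (simp add: B.annihilated_by_def)
    then have "r' \<odot>\<^bsub>B\<^esub> x \<oplus>\<^bsub>B\<^esub> (\<ominus>\<^bsub>B\<^esub> (r \<odot>\<^bsub>B\<^esub> x)) = \<zero>\<^bsub>B\<^esub>"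
      using c xc by (simp add: R.minus_eq B.smult_l_distr B.smult_l_minus)
    then show ?thesis
      using c xc B.M.minus_equality[of "r' \<odot>\<^bsub>B\<^esub> x" "\<ominus>\<^bsub>B\<^esub> (r \<odot>\<^bsub>B\<^esub> x)"] by simp
  qed
  have "(THE y. \<exists>n r. (\<forall>a\<in>ideal_power R m n. a \<odot>\<^bsub>B\<^esub> x = \<zero>\<^bsub>B\<^esub>) \<and> r \<in> s n \<and> y = r \<odot>\<^bsub>B\<^esub> x) = r \<odot>\<^bsub>B\<^esub> x"
  proof (rule the_equality)
    show "\<exists>n r'. (\<forall>a\<in>ideal_power R m n. a \<odot>\<^bsub>B\<^esub> x = \<zero>\<^bsub>B\<^esub>) \<and> r' \<in> s n \<and> r \<odot>\<^bsub>B\<^esub> x = r' \<odot>\<^bsub>B\<^esub> x"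
      using x r unfolding B.annihilated_by_def by blast
    fix y assume "\<exists>k r. (\<forall>a\<in>ideal_power R m k. a \<odot>\<^bsub>B\<^esub> x = \<zero>\<^bsub>B\<^esub>) \<and> r \<in> s k \<and> y = r \<odot>\<^bsub>B\<^esub> x"
    then obtain k r' where k: "\<forall>a\<in>ideal_power R m k. a \<odot>\<^bsub>B\<^esub> x = \<zero>\<^bsub>B\<^esub>" "r' \<in> s k" "y = r' \<odot>\<^bsub>B\<^esub> x"
      by blast
    have xk: "x \<in> B.annihilated_by (ideal_power R m k)" using k(1) xc by (simp add: B.annihilated_by_def)
    show "y = r \<odot>\<^bsub>B\<^esub> x"
    proof (cases "n \<le> k")
      case True
      then show ?thesis using aux[OF True r k(2) x] k(3) by simp
    next
      case False
      then have "k \<le> n" by simp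
      then show ?thesis using aux[OF _ k(2) r xk] k(3) by simp
    qed
  qed
  then show ?thesis by (simp add: completed_module_def)
qed

end

section \<open>The dual of an Artinian module\<close>

locale artinian_dual = noetherian_local_ring_hull R m E + artinian_over_local R m B
  for R :: "('a, 'r) ring_scheme" (structure) and m :: "'a set"
    and E :: "('a, 'e, 'z) module_scheme" and B :: "('a, 'b, 'y) module_scheme"
begin

abbreviation "Rhat \<equiv> completion R m"
abbreviation "D \<equiv> dual_module R m E B"

lemma dual_simps:
  "carrier D = lin_maps R B E" "\<zero>\<^bsub>D\<^esub> = (\<lambda>x\<in>carrier B. \<zero>\<^bsub>E\<^esub>)"
  "f \<oplus>\<^bsub>D\<^esub> g = (\<lambda>x\<in>carrier B. f x \<oplus>\<^bsub>E\<^esub> g x)"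
  by (simp_all add: dual_module_def)

lemma lin_maps_zero_map: "(\<lambda>x\<in>carrier B. \<zero>\<^bsub>E\<^esub>) \<in> lin_maps R B E"
  by (rule lin_mapsI) simp_all

lemma lin_maps_add:
  assumes f: "f \<in> lin_maps R B E" and g: "g \<in> lin_maps R B E"
  shows "(\<lambda>x\<in>carrier B. f x \<oplus>\<^bsub>E\<^esub> g x) \<in> lin_maps R B E"
  by (rule lin_mapsI)
    (simp_all add: lin_mapsD[OF f] lin_mapsD[OF g] E.smult_r_distr E.add.m_ac)

lemma lin_maps_neg:
  assumes f: "f \<in> lin_maps R B E"
  shows "(\<lambda>x\<in>carrier B. \<ominus>\<^bsub>E\<^esub> f x) \<in> lin_maps R B E"
  by (rule lin_mapsI) (simp_all add: lin_mapsD[OF f] E.smult_r_minus E.M.minus_add)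

lemma dual_abelian_group: "abelian_group D"
proof (rule abelian_groupI; unfold dual_simps)
  fix f g h assume f: "f \<in> lin_maps R B E"
  show "\<exists>g\<in>lin_maps R B E. (\<lambda>x\<in>carrier B. g x \<oplus>\<^bsub>E\<^esub> f x) = (\<lambda>x\<in>carrier B. \<zero>\<^bsub>E\<^esub>)"
    by (rule bexI[OF _ lin_maps_neg[OF f]]) (simp add: restrict_def fun_eq_iff lin_mapsD[OF f] E.l_neg)
  show "(\<lambda>x\<in>carrier B. (\<lambda>x\<in>carrier B. \<zero>\<^bsub>E\<^esub>) x \<oplus>\<^bsub>E\<^esub> f x) = f"
    by (rule lin_maps_eqI[OF lin_maps_add[OF lin_maps_zero_map f] f]) (simp add: lin_mapsD[OF f])
  assume g: "g \<in> lin_maps R B E"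
  show "(\<lambda>x\<in>carrier B. f x \<oplus>\<^bsub>E\<^esub> g x) \<in> lin_maps R B E" by (rule lin_maps_add[OF f g])
  show "(\<lambda>x\<in>carrier B. f x \<oplus>\<^bsub>E\<^esub> g x) = (\<lambda>x\<in>carrier B. g x \<oplus>\<^bsub>E\<^esub> f x)"
    by (simp add: restrict_def fun_eq_iff lin_mapsD[OF f] lin_mapsD[OF g] E.add.m_comm)
  assume h: "h \<in> lin_maps R B E"
  show "(\<lambda>x\<in>carrier B. (\<lambda>x\<in>carrier B. f x \<oplus>\<^bsub>E\<^esub> g x) x \<oplus>\<^bsub>E\<^esub> h x) =
        (\<lambda>x\<in>carrier B. f x \<oplus>\<^bsub>E\<^esub> (\<lambda>x\<in>carrier B. g x \<oplus>\<^bsub>E\<^esub> h x) x)"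
    by (simp add: restrict_def fun_eq_iff lin_mapsD[OF f] lin_mapsD[OF g] lin_mapsD[OF h] E.add.m_assoc)
qed (rule lin_maps_zero_map)

lemma dual_uminus:
  assumes f: "f \<in> lin_maps R B E"
  shows "\<ominus>\<^bsub>D\<^esub> f = (\<lambda>x\<in>carrier B. \<ominus>\<^bsub>E\<^esub> f x)"
  by (rule abelian_group.minus_equality[OF dual_abelian_group])
    (simp_all add: dual_simps f lin_maps_neg lin_mapsD[OF f] E.l_neg cong: restrict_cong)

lemma dual_smult_apply:
  assumes s: "s \<in> carrier Rhat" and f: "f \<in> lin_maps R B E"
    and x: "x \<in> B.annihilated_by (ideal_power R m n)" and r: "r \<in> s n"
  shows "(s \<odot>\<^bsub>D\<^esub> f) x = r \<odot>\<^bsub>E\<^esub> f x"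
proof -
  have "x \<in> carrier B" using x by (simp add: B.annihilated_by_def)
  moreover have "r \<in> carrier R" using completion_carrierD(2)[OF s, of n] r by (rule subsetD)
  ultimately show ?thesis
    using completed_smult[OF s x r] lin_mapsD(3)[OF f] by (simp add: dual_module_def)
qed

text \<open>
  Additivity needs one exponent for both arguments, so that both are multiplied by the same
  representative of \<open>s\<close>.
\<close>

lemma dual_smult_closed:
  assumes s: "s \<in> carrier Rhat" and f: "f \<in> lin_maps R B E"
  shows "s \<odot>\<^bsub>D\<^esub> f \<in> lin_maps R B E"
proof (rule lin_mapsI)
  note fD = lin_mapsD[OF f]
  show "(s \<odot>\<^bsub>D\<^esub> f) x = undefined" if "x \<notin> carrier B" for x
    using that by (simp add: dual_module_def)
  fix x assume x: "x \<in> carrier B"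
  {
    fix y assume y: "y \<in> carrier B"
    obtain n where n: "x \<in> B.annihilated_by (ideal_power R m n)"
      "y \<in> B.annihilated_by (ideal_power R m n)" by (rule torsion2[OF x y])
    obtain r where r: "r \<in> s n" using completion_carrierD(1)[OF s, of n] by (elim exE)
    have rc: "r \<in> carrier R" using completion_carrierD(2)[OF s, of n] r by (rule subsetD)
    note sub = B.submoduleE[OF B.submodule_annihilated_by[OF ideal_power_subset, of n]]
    note ap = dual_smult_apply[OF s f _ r]
    show "(s \<odot>\<^bsub>D\<^esub> f) (x \<oplus>\<^bsub>B\<^esub> y) = (s \<odot>\<^bsub>D\<^esub> f) x \<oplus>\<^bsub>E\<^esub> (s \<odot>\<^bsub>D\<^esub> f) y"
      using ap[OF n(1)] ap[OF n(2)] ap[OF sub(5)[OF n]] rc fD x y by (simp add: E.smult_r_distr)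
  }
  obtain n where n: "x \<in> B.annihilated_by (ideal_power R m n)" using torsion[OF x] by (elim exE)
  obtain r where r: "r \<in> s n" using completion_carrierD(1)[OF s, of n] by (elim exE)
  have rc: "r \<in> carrier R" using completion_carrierD(2)[OF s, of n] r by (rule subsetD)
  note sub = B.submoduleE[OF B.submodule_annihilated_by[OF ideal_power_subset, of n]]
  note ap = dual_smult_apply[OF s f _ r]
  show "(s \<odot>\<^bsub>D\<^esub> f) x \<in> carrier E" using ap[OF n] rc fD(1)[OF x] by simp
  show "(s \<odot>\<^bsub>D\<^esub> f) (a \<odot>\<^bsub>B\<^esub> x) = a \<odot>\<^bsub>E\<^esub> (s \<odot>\<^bsub>D\<^esub> f) x" if a: "a \<in> carrier R" for a
    using ap[OF n] ap[OF sub(4)[OF a n]] fD(3)[OF a x] E.smult_left_commute[OF rc a fD(1)[OF x]] by simp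
qed

subsection \<open>Orthogonal submodules\<close>

definition perp :: "'b set \<Rightarrow> ('b \<Rightarrow> 'e) set" where
  "perp C = {f \<in> lin_maps R B E. \<forall>x\<in>C. f x = \<zero>\<^bsub>E\<^esub>}"

definition common_kernel :: "('b \<Rightarrow> 'e) set \<Rightarrow> 'b set" where
  "common_kernel S = {x \<in> carrier B. \<forall>f\<in>S. f x = \<zero>\<^bsub>E\<^esub>}"

lemma perp_subset: "perp C \<subseteq> lin_maps R B E"
  by (auto simp: perp_def)

lemma subset_perp_iff:
  assumes "C \<subseteq> carrier B" "S \<subseteq> lin_maps R B E"
  shows "S \<subseteq> perp C \<longleftrightarrow> C \<subseteq> common_kernel S"
  using assms unfolding perp_def common_kernel_def by blast

lemma perp_antimono: "C \<subseteq> C' \<Longrightarrow> perp C' \<subseteq> perp C"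
  unfolding perp_def by blast

lemma common_kernel_antimono: "S \<subseteq> S' \<Longrightarrow> common_kernel S' \<subseteq> common_kernel S"
  unfolding common_kernel_def by blast

lemma common_kernel_subset: "common_kernel S \<subseteq> carrier B"
  unfolding common_kernel_def by blast

lemma submodule_perp:
  assumes C: "C \<subseteq> carrier B"
  shows "submodule (perp C) Rhat D"
  unfolding submodule_def submodule_axioms_def
proof (intro conjI allI impI)
  show "subgroup (perp C) (add_monoid D)"
  proof (rule group.subgroupI[OF abelian_group.a_group[OF dual_abelian_group]])
    show "perp C \<subseteq> carrier (add_monoid D)" by (simp add: dual_simps perp_subset)
    show "perp C \<noteq> {}" using lin_maps_zero_map C by (auto simp: perp_def subset_iff intro!: exI[of _ "\<lambda>x\<in>carrier B. \<zero>\<^bsub>E\<^esub>"])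
    have neg0: "\<ominus>\<^bsub>E\<^esub> \<zero>\<^bsub>E\<^esub> = \<zero>\<^bsub>E\<^esub>" by (rule E.M.minus_equality) simp_all
    show "inv\<^bsub>add_monoid D\<^esub> f \<in> perp C" if "f \<in> perp C" for f
    proof -
      have f: "f \<in> lin_maps R B E" using that by (simp add: perp_def)
      show ?thesis
        using that dual_uminus[OF f] lin_maps_neg[OF f] C neg0
        by (auto simp: a_inv_def perp_def)
    qed
    show "f \<otimes>\<^bsub>add_monoid D\<^esub> g \<in> perp C" if "f \<in> perp C" "g \<in> perp C" for f g
      using that lin_maps_add[of f g] C by (auto simp: dual_simps perp_def)
  qed
  fix s f assume s: "s \<in> carrier Rhat" and "f \<in> perp C"
  then have f: "f \<in> lin_maps R B E" "\<And>x. x \<in> C \<Longrightarrow> f x = \<zero>\<^bsub>E\<^esub>" by (simp_all add: perp_def)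
  have "(s \<odot>\<^bsub>D\<^esub> f) x = \<zero>\<^bsub>E\<^esub>" if x: "x \<in> C" for x
  proof -
    obtain n where n: "x \<in> B.annihilated_by (ideal_power R m n)"
      using torsion[OF subsetD[OF C x]] by (elim exE)
    obtain r where r: "r \<in> s n" using completion_carrierD(1)[OF s, of n] by (elim exE)
    have "r \<in> carrier R" using completion_carrierD(2)[OF s, of n] r by (rule subsetD)
    then show ?thesis using dual_smult_apply[OF s f(1) n r] f(2)[OF x] by simp
  qed
  then show "s \<odot>\<^bsub>D\<^esub> f \<in> perp C" using dual_smult_closed[OF s f(1)] by (simp add: perp_def)
qed

lemma submodule_common_kernel:
  assumes S: "S \<subseteq> lin_maps R B E"
  shows "submodule (common_kernel S) R B"
proof (rule B.submoduleI)
  have fD: "f \<in> lin_maps R B E" if "f \<in> S" for f using S that by blast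
  have neg0: "\<ominus>\<^bsub>E\<^esub> \<zero>\<^bsub>E\<^esub> = \<zero>\<^bsub>E\<^esub>" by (rule E.M.minus_equality) simp_all
  show "\<zero>\<^bsub>B\<^esub> \<in> common_kernel S"
    using lin_maps_zero[OF B.module_axioms E.module_axioms fD] by (simp add: common_kernel_def)
  show "\<ominus>\<^bsub>B\<^esub> x \<in> common_kernel S" if "x \<in> common_kernel S" for x
    using that by (auto simp: common_kernel_def lin_maps_minus[OF B.module_axioms E.module_axioms fD] neg0)
  show "x \<oplus>\<^bsub>B\<^esub> y \<in> common_kernel S" if "x \<in> common_kernel S" "y \<in> common_kernel S" for x y
  proof -
    have xy: "x \<in> carrier B" "y \<in> carrier B" using that by (simp_all add: common_kernel_def)
    have "f (x \<oplus>\<^bsub>B\<^esub> y) = \<zero>\<^bsub>E\<^esub>" if f: "f \<in> S" for f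
    proof -
      have "f x = \<zero>\<^bsub>E\<^esub>" "f y = \<zero>\<^bsub>E\<^esub>"
        using f \<open>x \<in> common_kernel S\<close> \<open>y \<in> common_kernel S\<close> by (simp_all add: common_kernel_def)
      then show ?thesis using lin_mapsD(2)[OF fD[OF f] xy] by simp
    qed
    then show ?thesis using xy by (simp add: common_kernel_def)
  qed
  show "r \<odot>\<^bsub>B\<^esub> x \<in> common_kernel S" if "r \<in> carrier R" "x \<in> common_kernel S" for r x
    using that by (auto simp: common_kernel_def lin_mapsD(3)[OF fD])
qed (rule common_kernel_subset)

text \<open>
  \<open>E\<close> is a cogenerator: as \<open>r x \<in> C\<close> forces \<open>r \<in> m\<close> for \<open>x \<notin> C\<close>, the rule \<open>c + r x \<mapsto> r e\<close>, with \<open>e\<close>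
  spanning the socle, is well defined on \<open>C + R x\<close>, and it extends to \<open>B\<close>.
\<close>

lemma separating_map:
  assumes C: "submodule C R B" and x: "x \<in> carrier B" "x \<notin> C"
  shows "\<exists>f\<in>perp C. f x \<noteq> \<zero>\<^bsub>E\<^esub>"
proof -
  from socle_generator obtain e where e: "e \<in> carrier E" "e \<noteq> \<zero>\<^bsub>E\<^esub>"
    "\<forall>a\<in>m. a \<odot>\<^bsub>E\<^esub> e = \<zero>\<^bsub>E\<^esub>" by (elim bexE conjE)
  note CE = B.submoduleE[OF C]
  have Cc: "c \<in> carrier B" if "c \<in> C" for c using CE(1) that by blast
  define G where "G = {(c \<oplus>\<^bsub>B\<^esub> r \<odot>\<^bsub>B\<^esub> x, r \<odot>\<^bsub>E\<^esub> e) | c r. c \<in> C \<and> r \<in> carrier R}"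
  have in_G: "(c \<oplus>\<^bsub>B\<^esub> r \<odot>\<^bsub>B\<^esub> x, r \<odot>\<^bsub>E\<^esub> e) \<in> G" if "c \<in> C" "r \<in> carrier R" for c r
    unfolding G_def using that by blast
  have zC: "\<zero>\<^bsub>B\<^esub> \<in> C" by (rule B.submodule_zero[OF C])
  have "linear_graph R B E G"
    unfolding linear_graph_def
  proof (intro conjI allI impI)
    show "G \<subseteq> carrier B \<times> carrier E" using Cc x e by (auto simp: G_def)
    show "(\<zero>\<^bsub>B\<^esub>, \<zero>\<^bsub>E\<^esub>) \<in> G" using in_G[OF zC R.zero_closed] x e by simp
    fix u f assume "(u, f) \<in> G"
    then obtain c r where r: "c \<in> C" "r \<in> carrier R" "u = c \<oplus>\<^bsub>B\<^esub> r \<odot>\<^bsub>B\<^esub> x" "f = r \<odot>\<^bsub>E\<^esub> e"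
      by (auto simp: G_def)
    {
      fix u' f' assume "(u', f') \<in> G"
      then obtain c' r' where r': "c' \<in> C" "r' \<in> carrier R" "u' = c' \<oplus>\<^bsub>B\<^esub> r' \<odot>\<^bsub>B\<^esub> x" "f' = r' \<odot>\<^bsub>E\<^esub> e"
        by (auto simp: G_def)
      have "u \<oplus>\<^bsub>B\<^esub> u' = (c \<oplus>\<^bsub>B\<^esub> c') \<oplus>\<^bsub>B\<^esub> (r \<oplus> r') \<odot>\<^bsub>B\<^esub> x" "f \<oplus>\<^bsub>E\<^esub> f' = (r \<oplus> r') \<odot>\<^bsub>E\<^esub> e"
        using r r' Cc x(1) e(1) by (simp_all add: B.smult_l_distr E.smult_l_distr B.add.m_ac)
      then show "(u \<oplus>\<^bsub>B\<^esub> u', f \<oplus>\<^bsub>E\<^esub> f') \<in> G"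
        using in_G[OF CE(5)[OF r(1) r'(1)], of "r \<oplus> r'"] r(2) r'(2) by simp
    }
    fix s assume s: "s \<in> carrier R"
    have "s \<odot>\<^bsub>B\<^esub> u = s \<odot>\<^bsub>B\<^esub> c \<oplus>\<^bsub>B\<^esub> (s \<otimes> r) \<odot>\<^bsub>B\<^esub> x" "s \<odot>\<^bsub>E\<^esub> f = (s \<otimes> r) \<odot>\<^bsub>E\<^esub> e"
      using r Cc x(1) e(1) s by (simp_all add: B.smult_r_distr B.smult_assoc1 E.smult_assoc1)
    then show "(s \<odot>\<^bsub>B\<^esub> u, s \<odot>\<^bsub>E\<^esub> f) \<in> G"
      using in_G[OF CE(4)[OF s r(1)], of "s \<otimes> r"] r(2) s by simp
  next
    fix f assume "(\<zero>\<^bsub>B\<^esub>, f) \<in> G"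
    then obtain c r where r: "c \<in> C" "r \<in> carrier R" "\<zero>\<^bsub>B\<^esub> = c \<oplus>\<^bsub>B\<^esub> r \<odot>\<^bsub>B\<^esub> x" "f = r \<odot>\<^bsub>E\<^esub> e"
      by (auto simp: G_def)
    have "\<ominus>\<^bsub>B\<^esub> c = r \<odot>\<^bsub>B\<^esub> x"
      using r Cc x by (intro B.M.minus_equality) (simp_all add: B.add.m_comm)
    then have rx: "r \<odot>\<^bsub>B\<^esub> x \<in> C" using CE(3)[OF r(1)] by simp
    have "r \<in> m"
    proof (rule ccontr)
      assume "r \<notin> m"
      then obtain s where s: "s \<in> carrier R" "s \<otimes> r = \<one>" by (rule unit_if_notin_m[OF r(2)])
      have "x = s \<odot>\<^bsub>B\<^esub> (r \<odot>\<^bsub>B\<^esub> x)" using s x(1) r(2) by (simp add: B.smult_assoc1[symmetric])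
      also have "\<dots> \<in> C" by (rule CE(4)[OF s(1) rx])
      finally show False using x(2) by simp
    qed
    then show "f = \<zero>\<^bsub>E\<^esub>" using r(4) e(3) by simp
  qed
  from linear_graph_extends[OF injective_E B.module_axioms this]
  obtain f where f: "f \<in> lin_maps R B E" "\<forall>(u, v)\<in>G. f u = v" by (elim bexE)
  have ap: "f (c \<oplus>\<^bsub>B\<^esub> r \<odot>\<^bsub>B\<^esub> x) = r \<odot>\<^bsub>E\<^esub> e" if "c \<in> C" "r \<in> carrier R" for c r
    using bspec[OF f(2) in_G[OF that]] by simp
  have "f c = \<zero>\<^bsub>E\<^esub>" if "c \<in> C" for c using ap[OF that R.zero_closed] x(1) e(1) Cc[OF that] by simp
  moreover have "f x = e" using ap[OF zC R.one_closed] x(1) e(1) by simp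
  ultimately show ?thesis using f(1) e(2) by (intro bexI[of _ f]) (simp_all add: perp_def)
qed

lemma common_kernel_perp:
  assumes C: "submodule C R B"
  shows "common_kernel (perp C) = C"
proof
  show "common_kernel (perp C) \<subseteq> C"
    using separating_map[OF C] unfolding common_kernel_def by blast
  show "C \<subseteq> common_kernel (perp C)"
    using B.submoduleE(1)[OF C] unfolding common_kernel_def perp_def by blast
qed

text \<open>
  Among the common kernels of finite subsets of \<open>S\<close> there is a minimal one, and adding a further map
  of \<open>S\<close> cannot shrink it.
\<close>

lemma finite_subset_same_kernel:
  assumes S: "S \<subseteq> lin_maps R B E"
  obtains S' where "finite S'" "S' \<subseteq> S" "common_kernel S' = common_kernel S"
proof -
  let ?P = "common_kernel ` {S'. finite S' \<and> S' \<subseteq> S}"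
  have "\<exists>U\<in>?P. \<forall>V\<in>?P. V \<subseteq> U \<longrightarrow> V = U"
    by (rule artinian_module_minimal[OF artinian, of "common_kernel {}"])
      (use S in \<open>auto intro: submodule_common_kernel\<close>)
  then obtain S' where S': "finite S'" "S' \<subseteq> S"
    "\<forall>V\<in>?P. V \<subseteq> common_kernel S' \<longrightarrow> V = common_kernel S'" by blast
  have "common_kernel S' \<subseteq> common_kernel S"
  proof
    fix x assume x: "x \<in> common_kernel S'"
    have "f x = \<zero>\<^bsub>E\<^esub>" if f: "f \<in> S" for f
    proof -
      have "common_kernel (insert f S') \<in> ?P" using S'(1,2) f by blast
      then have "common_kernel (insert f S') = common_kernel S'"
        using S'(3) common_kernel_antimono[of S' "insert f S'"] by blast
      then show ?thesis using x by (auto simp: common_kernel_def)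
    qed
    then show "x \<in> common_kernel S" using x by (simp add: common_kernel_def)
  qed
  then show thesis using that[OF S'(1,2)] common_kernel_antimono[OF S'(2)] by blast
qed

text \<open>
  A map vanishing on the common kernel is a sum of maps \<open>\<phi> \<circ> g\<close> with \<open>g \<in> S\<close>. Since \<open>g\<close> takes values
  killed by powers of \<open>m\<close>, each \<open>\<phi> \<circ> g\<close> is a multiple of \<open>g\<close> by an element of the completion.
\<close>

lemma perp_common_kernel_subset:
  assumes S: "finite S" "S \<subseteq> lin_maps R B E" and H: "submodule H Rhat D" "S \<subseteq> H"
  shows "perp (common_kernel S) \<subseteq> H"
proof
  fix f assume "f \<in> perp (common_kernel S)"
  then have f: "f \<in> lin_maps R B E" "\<And>x. x \<in> common_kernel S \<Longrightarrow> f x = \<zero>\<^bsub>E\<^esub>"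
    by (simp_all add: perp_def)
  note Hg = submodule.axioms(1)[OF H(1)]
  have HD: "H \<subseteq> lin_maps R B E" using subgroup.subset[OF Hg] by (simp add: dual_simps)
  have "\<exists>h\<in>H. \<forall>x\<in>carrier B. f x = h x"
  proof (rule vanishing_on_common_kernel[OF injective_E B.module_axioms HD _ _ f(1) S])
    show "(\<lambda>x\<in>carrier B. \<zero>\<^bsub>E\<^esub>) \<in> H" using subgroup.one_closed[OF Hg] by (simp add: dual_simps)
    show "(\<lambda>x\<in>carrier B. h x \<oplus>\<^bsub>E\<^esub> h' x) \<in> H" if "h \<in> H" "h' \<in> H" for h h'
      using subgroup.m_closed[OF Hg that] by (simp add: dual_simps)
    show "submodule (carrier B) R B" by (rule B.carrier_is_submodule)
    show "f x = \<zero>\<^bsub>E\<^esub>" if "x \<in> carrier B" "\<forall>g\<in>S. g x = \<zero>\<^bsub>E\<^esub>" for x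
      using that by (intro f(2)) (simp add: common_kernel_def)
    fix g \<phi> assume g: "g \<in> S" and \<phi>: "\<phi> \<in> lin_maps R E E"
    have gl: "g \<in> lin_maps R B E" using g S(2) by blast
    from endomorphism_is_completion_scalar[OF \<phi>]
    obtain s where s: "s \<in> carrier Rhat"
      "\<forall>n. \<forall>y\<in>E.annihilated_by (ideal_power R m n). \<forall>r\<in>s n. \<phi> y = r \<odot>\<^bsub>E\<^esub> y"
      by (elim bexE)
    have "(s \<odot>\<^bsub>D\<^esub> g) x = \<phi> (g x)" if x: "x \<in> carrier B" for x
    proof -
      obtain n where n: "x \<in> B.annihilated_by (ideal_power R m n)" using torsion[OF x] by (elim exE)
      obtain r where r: "r \<in> s n" using completion_carrierD(1)[OF s(1), of n] by (elim exE)
      have "a \<odot>\<^bsub>E\<^esub> g x = \<zero>\<^bsub>E\<^esub>" if a: "a \<in> ideal_power R m n" for a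
        using lin_mapsD(3)[OF gl subsetD[OF ideal_power_subset a] x] n a
          lin_maps_zero[OF B.module_axioms E.module_axioms gl] by (simp add: B.annihilated_by_def)
      then have "g x \<in> E.annihilated_by (ideal_power R m n)"
        using lin_mapsD(1)[OF gl x] by (simp add: E.annihilated_by_def)
      from s(2)[rule_format, OF this r] show ?thesis using dual_smult_apply[OF s(1) gl n r] by simp
    qed
    moreover have "s \<odot>\<^bsub>D\<^esub> g \<in> H" using submodule.smult_closed[OF H(1) s(1)] g H(2) by blast
    ultimately show "\<exists>h\<in>H. \<forall>x\<in>carrier B. h x = \<phi> (g x)" by blast
  qed
  then obtain h where h: "h \<in> H" "\<forall>x\<in>carrier B. f x = h x" by (elim bexE)
  have "f = h" by (rule lin_maps_eqI[OF f(1) subsetD[OF HD h(1)]]) (use h(2) in simp)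
  then show "f \<in> H" using h(1) by simp
qed

text \<open>
  The set \<open>S\<close> may be infinite: a finite subset with the same common kernel already generates
  everything that \<open>S\<close> can generate.
\<close>

theorem gen_submodule_dual:
  assumes S: "S \<subseteq> lin_maps R B E"
  shows "gen_submodule Rhat D S = perp (common_kernel S)"
proof
  show "gen_submodule Rhat D S \<subseteq> perp (common_kernel S)"
    using submodule_perp[OF common_kernel_subset, of S] subset_perp_iff[OF common_kernel_subset S, of S]
    unfolding gen_submodule_def by blast
  obtain S' where S': "finite S'" "S' \<subseteq> S" "common_kernel S' = common_kernel S"
    by (rule finite_subset_same_kernel[OF S])
  have "perp (common_kernel S') \<subseteq> H" if "submodule H Rhat D" "S \<subseteq> H" for H
    using perp_common_kernel_subset[OF S'(1) _ that(1)] S'(2) S that(2) by blast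
  then show "perp (common_kernel S) \<subseteq> gen_submodule Rhat D S"
    unfolding gen_submodule_def S'(3) by blast
qed

lemma finitely_generated_perp:
  assumes C: "submodule C R B"
  shows "finitely_generated Rhat D (perp C)"
proof -
  obtain S where S: "finite S" "S \<subseteq> perp C" "common_kernel S = common_kernel (perp C)"
    by (rule finite_subset_same_kernel[OF perp_subset])
  have "gen_submodule Rhat D S = perp C"
    using gen_submodule_dual[OF subset_trans[OF S(2) perp_subset]] S(3) common_kernel_perp[OF C] by simp
  then show ?thesis unfolding finitely_generated_def using S(1,2) by blast
qed

lemma finitely_generated_is_perp:
  assumes N: "submodule N Rhat D" "finitely_generated Rhat D N"
  shows "perp (common_kernel N) = N"
proof
  have NB: "N \<subseteq> lin_maps R B E"
    using subgroup.subset[OF submodule.axioms(1)[OF N(1)]] by (simp add: dual_simps)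
  obtain S where S: "S \<subseteq> N" "finite S" "gen_submodule Rhat D S = N"
    using N(2) unfolding finitely_generated_def by blast
  have "perp (common_kernel N) \<subseteq> perp (common_kernel S)"
  proof (rule perp_antimono)
    have "N = perp (common_kernel S)" using S(3) gen_submodule_dual[OF subset_trans[OF S(1) NB]] by simp
    then show "common_kernel S \<subseteq> common_kernel N"
      using subset_perp_iff[OF common_kernel_subset NB] by blast
  qed
  then show "perp (common_kernel N) \<subseteq> N"
    using S(3) gen_submodule_dual[OF subset_trans[OF S(1) NB]] by simp
  show "N \<subseteq> perp (common_kernel N)" using subset_perp_iff[OF common_kernel_subset NB] by blast
qed

lemma gen_submodule_eq_perp_iff:
  assumes C: "submodule C R B" and S: "S \<subseteq> lin_maps R B E"
  shows "gen_submodule Rhat D S = perp C \<longleftrightarrow> common_kernel S = C"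
  using gen_submodule_dual[OF S] common_kernel_perp[OF C]
    common_kernel_perp[OF submodule_common_kernel[OF S]] by metis

text \<open>
  Minimality among all subsets reduces to omitting one map at a time, because common kernels grow
  when maps are omitted.
\<close>

lemma minimal_generating_set_perp_iff:
  assumes C: "submodule C R B"
  shows "minimal_generating_set Rhat D (perp C) S \<longleftrightarrow>
    S \<subseteq> lin_maps R B E \<and> common_kernel S = C \<and> (\<forall>g\<in>S. common_kernel (S - {g}) \<noteq> C)"
    (is "?L \<longleftrightarrow> ?K")
proof
  assume L: ?L
  then have S: "S \<subseteq> lin_maps R B E"
    using perp_subset unfolding minimal_generating_set_def by blast
  have min: "gen_submodule Rhat D T \<noteq> perp C" if "T \<subset> S" for T
    using L that unfolding minimal_generating_set_def by blast
  have "common_kernel (S - {g}) \<noteq> C" if "g \<in> S" for g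
    using min[of "S - {g}"] gen_submodule_eq_perp_iff[OF C, of "S - {g}"] S that by blast
  moreover have "common_kernel S = C"
    using L gen_submodule_eq_perp_iff[OF C S] unfolding minimal_generating_set_def by simp
  ultimately show ?K using S by blast
next
  assume K: ?K
  have "gen_submodule Rhat D T \<noteq> perp C" if T: "T \<subset> S" for T
  proof
    assume "gen_submodule Rhat D T = perp C"
    then have "common_kernel T = C" using gen_submodule_eq_perp_iff[OF C, of T] T K by blast
    moreover obtain g where g: "g \<in> S" "g \<notin> T" using T by blast
    moreover have "common_kernel (S - {g}) \<subseteq> common_kernel T"
      by (rule common_kernel_antimono) (use T g in blast)
    moreover have "common_kernel S \<subseteq> common_kernel (S - {g})" by (rule common_kernel_antimono) blast
    ultimately show False using K by blast
  qed
  moreover have "S \<subseteq> perp C"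
    using subset_perp_iff[of C S] B.submoduleE(1)[OF C] K by blast
  moreover have "gen_submodule Rhat D S = perp C"
    using gen_submodule_eq_perp_iff[OF C, of S] K by blast
  ultimately show ?L unfolding minimal_generating_set_def by blast
qed

text \<open>
  Generating sets are arbitrary sets while cogenerating sets are finite lists, so the two can
  correspond only if minimal generating sets are finite.
\<close>

lemma minimal_generating_set_finite:
  assumes C: "submodule C R B" and S: "minimal_generating_set Rhat D (perp C) S"
  shows "finite S"
proof -
  have K: "S \<subseteq> lin_maps R B E" "common_kernel S = C" "\<forall>g\<in>S. common_kernel (S - {g}) \<noteq> C"
    using S minimal_generating_set_perp_iff[OF C] by simp_all
  obtain S' where S': "finite S'" "S' \<subseteq> S" "common_kernel S' = common_kernel S"
    by (rule finite_subset_same_kernel[OF K(1)])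
  have "S \<subseteq> S'"
  proof
    fix g assume g: "g \<in> S"
    show "g \<in> S'"
    proof (rule ccontr)
      assume "g \<notin> S'"
      then have "common_kernel (S - {g}) \<subseteq> common_kernel S'"
        using S'(2) by (intro common_kernel_antimono) blast
      moreover have "common_kernel S \<subseteq> common_kernel (S - {g})" by (rule common_kernel_antimono) blast
      ultimately show False using K(2,3) S'(3) g by blast
    qed
  qed
  then show ?thesis using S'(1) by (rule finite_subset)
qed

subsection \<open>Maps on quotients\<close>

definition lift :: "'b set \<Rightarrow> ('b set \<Rightarrow> 'e) \<Rightarrow> 'b \<Rightarrow> 'e" where
  "lift C g = (\<lambda>x\<in>carrier B. g (C +>\<^bsub>B\<^esub> x))"

abbreviation "quot_maps C \<equiv> lin_maps R (quot_module R B C) E"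

lemma coset_in_quot: "x \<in> carrier B \<Longrightarrow> C +>\<^bsub>B\<^esub> x \<in> carrier (quot_module R B C)"
  by (simp add: B.quot_module_carrier)

lemma lift_in_perp:
  assumes C: "submodule C R B" and g: "g \<in> quot_maps C"
  shows "lift C g \<in> perp C"
proof -
  note gD = lin_mapsD[OF g]
  have "lift C g \<in> lin_maps R B E"
  proof (rule lin_mapsI)
    fix x assume x: "x \<in> carrier B"
    show "lift C g x \<in> carrier E" using gD(1)[OF coset_in_quot[OF x]] x by (simp add: lift_def)
    show "lift C g (x \<oplus>\<^bsub>B\<^esub> y) = lift C g x \<oplus>\<^bsub>E\<^esub> lift C g y" if y: "y \<in> carrier B" for y
      using gD(2)[OF coset_in_quot[OF x] coset_in_quot[OF y]] B.quot_module_add[OF C x y] x y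
      by (simp add: lift_def)
    show "lift C g (r \<odot>\<^bsub>B\<^esub> x) = r \<odot>\<^bsub>E\<^esub> lift C g x" if r: "r \<in> carrier R" for r
      using gD(3)[OF r coset_in_quot[OF x]] B.quot_module_smult[OF C r x] x r
      by (simp add: lift_def)
  qed (simp add: lift_def)
  moreover have "lift C g x = \<zero>\<^bsub>E\<^esub>" if x: "x \<in> C" for x
  proof -
    have xc: "x \<in> carrier B" using B.submoduleE(1)[OF C] x by blast
    have "C +>\<^bsub>B\<^esub> x = C +>\<^bsub>B\<^esub> \<zero>\<^bsub>B\<^esub>"
      using B.coset_eq_submodule_iff[OF C xc] B.coset_eq_submodule_iff[OF C B.M.zero_closed]
        B.submodule_zero[OF C] x by simp
    then have "lift C g x = lift C g \<zero>\<^bsub>B\<^esub>" using xc by (simp add: lift_def)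
    then show ?thesis using lin_maps_zero[OF B.module_axioms E.module_axioms calculation] by simp
  qed
  ultimately show ?thesis by (simp add: perp_def)
qed

lemma inj_on_lift: "inj_on (lift C) (quot_maps C)"
proof (rule inj_onI)
  fix g g' assume g: "g \<in> quot_maps C" "g' \<in> quot_maps C" and eq: "lift C g = lift C g'"
  show "g = g'"
  proof (rule lin_maps_eqI[OF g])
    fix W assume "W \<in> carrier (quot_module R B C)"
    then obtain x where x: "x \<in> carrier B" "W = C +>\<^bsub>B\<^esub> x" by (auto simp: B.quot_module_carrier)
    then show "g W = g' W" using fun_cong[OF eq, of x] by (simp add: lift_def)
  qed
qed

text \<open>
  A map vanishing on \<open>C\<close> takes the same value on all elements of a coset, so it descends to \<open>B/C\<close>
  through any choice of representatives.
\<close>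

lemma perp_subset_lift:
  assumes C: "submodule C R B" and f: "f \<in> perp C"
  shows "f \<in> lift C ` quot_maps C"
proof -
  have fl: "f \<in> lin_maps R B E" and f0: "\<And>x. x \<in> C \<Longrightarrow> f x = \<zero>\<^bsub>E\<^esub>" using f by (simp_all add: perp_def)
  note fD = lin_mapsD[OF fl]
  define g where "g = (\<lambda>W\<in>carrier (quot_module R B C). f (SOME x. x \<in> carrier B \<and> W = C +>\<^bsub>B\<^esub> x))"
  have g: "g (C +>\<^bsub>B\<^esub> x) = f x" if x: "x \<in> carrier B" for x
  proof -
    define y where "y = (SOME y. y \<in> carrier B \<and> C +>\<^bsub>B\<^esub> x = C +>\<^bsub>B\<^esub> y)"
    have "y \<in> carrier B \<and> C +>\<^bsub>B\<^esub> x = C +>\<^bsub>B\<^esub> y" unfolding y_def by (rule someI[of _ x]) (simp add: x)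
    then have y: "y \<in> carrier B" "x \<oplus>\<^bsub>B\<^esub> (\<ominus>\<^bsub>B\<^esub> y) \<in> C"
      using B.submodule_coset_eq_iff[OF C x, of y] by simp_all
    have "f x \<oplus>\<^bsub>E\<^esub> (\<ominus>\<^bsub>E\<^esub> f y) = \<zero>\<^bsub>E\<^esub>"
      using f0[OF y(2)] fD(2)[OF x, of "\<ominus>\<^bsub>B\<^esub> y"] y(1)
        lin_maps_minus[OF B.module_axioms E.module_axioms fl y(1)] by simp
    then have "f x = f y"
      using E.M.minus_equality[of "f x" "\<ominus>\<^bsub>E\<^esub> f y"] fD(1)[OF x] fD(1)[OF y(1)] by simp
    then show ?thesis using x by (simp add: g_def coset_in_quot y_def[symmetric])
  qed
  have "g \<in> quot_maps C"
  proof (rule lin_mapsI)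
    fix W assume "W \<in> carrier (quot_module R B C)"
    then obtain x where x: "x \<in> carrier B" "W = C +>\<^bsub>B\<^esub> x" by (auto simp: B.quot_module_carrier)
    show "g W \<in> carrier E" using g[OF x(1)] x fD(1) by simp
    show "g (r \<odot>\<^bsub>quot_module R B C\<^esub> W) = r \<odot>\<^bsub>E\<^esub> g W" if r: "r \<in> carrier R" for r
      using g[OF x(1)] g[of "r \<odot>\<^bsub>B\<^esub> x"] B.quot_module_smult[OF C r x(1)] r x fD(3) by simp
    fix W' assume "W' \<in> carrier (quot_module R B C)"
    then obtain y where y: "y \<in> carrier B" "W' = C +>\<^bsub>B\<^esub> y" by (auto simp: B.quot_module_carrier)
    show "g (W \<oplus>\<^bsub>quot_module R B C\<^esub> W') = g W \<oplus>\<^bsub>E\<^esub> g W'"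
      using g[OF x(1)] g[OF y(1)] g[of "x \<oplus>\<^bsub>B\<^esub> y"] B.quot_module_add[OF C x(1) y(1)] x y fD(2) by simp
  qed (simp add: g_def)
  moreover have "lift C g = f"
    using g fD(4) by (auto simp: lift_def restrict_def fun_eq_iff)
  ultimately show ?thesis by blast
qed

lemma lift_image: "submodule C R B \<Longrightarrow> lift C ` quot_maps C = perp C"
  using lift_in_perp perp_subset_lift by blast

lemma dual_of_quotient_eq: "submodule A R B \<Longrightarrow> dual_of_quotient R m E B A = perp A"
  using lift_image[of A] by (simp add: dual_of_quotient_def dual_module_def lift_def)

text \<open>
  Maps on \<open>B/A\<close> and \<open>B/C\<close> are compared through their composites with the projections from \<open>B\<close>. These
  do not notice the pull-back along \<open>B/C \<rightarrow> B/A\<close>, which therefore becomes the inclusion of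
  \<open>perp A\<close> in \<open>perp C\<close>.
\<close>

lemma pull_back_lift:
  assumes C: "submodule C R B" and A: "submodule A R B" and CA: "C \<subseteq> A" and g: "g \<in> quot_maps A"
  shows "pull_back R B C A g \<in> quot_maps C" and "lift C (pull_back R B C A g) = lift A g"
proof -
  note AE = B.submoduleE[OF A]
  have AC: "A <+>\<^bsub>B\<^esub> (C +>\<^bsub>B\<^esub> x) = A +>\<^bsub>B\<^esub> x" if x: "x \<in> carrier B" for x
  proof
    show "A <+>\<^bsub>B\<^esub> (C +>\<^bsub>B\<^esub> x) \<subseteq> A +>\<^bsub>B\<^esub> x"
    proof
      fix z assume "z \<in> A <+>\<^bsub>B\<^esub> (C +>\<^bsub>B\<^esub> x)"
      then obtain a c where ac: "a \<in> A" "c \<in> C" "z = a \<oplus>\<^bsub>B\<^esub> (c \<oplus>\<^bsub>B\<^esub> x)"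
        by (auto simp: set_add_def' a_r_coset_def')
      then have "c \<in> A" "a \<in> carrier B" "c \<in> carrier B" using CA AE(1) by auto
      then have "z = (a \<oplus>\<^bsub>B\<^esub> c) \<oplus>\<^bsub>B\<^esub> x" "a \<oplus>\<^bsub>B\<^esub> c \<in> A"
        using ac x AE(5) by (simp_all add: B.M.a_assoc)
      then show "z \<in> A +>\<^bsub>B\<^esub> x" by (auto simp: a_r_coset_def')
    qed
    show "A +>\<^bsub>B\<^esub> x \<subseteq> A <+>\<^bsub>B\<^esub> (C +>\<^bsub>B\<^esub> x)"
    proof
      fix z assume "z \<in> A +>\<^bsub>B\<^esub> x"
      then obtain a where a: "a \<in> A" "z = a \<oplus>\<^bsub>B\<^esub> x" by (auto simp: a_r_coset_def')
      have "\<zero>\<^bsub>B\<^esub> \<oplus>\<^bsub>B\<^esub> x \<in> C +>\<^bsub>B\<^esub> x" using B.submodule_zero[OF C] by (auto simp: a_r_coset_def')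
      then show "z \<in> A <+>\<^bsub>B\<^esub> (C +>\<^bsub>B\<^esub> x)" using a x by (auto simp: set_add_def')
    qed
  qed
  have ap: "pull_back R B C A g (C +>\<^bsub>B\<^esub> x) = lift A g x" if x: "x \<in> carrier B" for x
    using AC[OF x] x by (simp add: pull_back_def lift_def coset_in_quot)
  then show eq: "lift C (pull_back R B C A g) = lift A g"
    by (simp add: lift_def restrict_def fun_eq_iff)
  have "lift A g \<in> perp C" using lift_in_perp[OF A g] perp_antimono[OF CA] by blast
  then obtain g' where g': "g' \<in> quot_maps C" "lift A g = lift C g'"
    using perp_subset_lift[OF C] by blast
  have "pull_back R B C A g = g'"
  proof
    fix W
    show "pull_back R B C A g W = g' W"
    proof (cases "W \<in> carrier (quot_module R B C)")
      case True
      then obtain x where x: "x \<in> carrier B" "W = C +>\<^bsub>B\<^esub> x" by (auto simp: B.quot_module_carrier)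
      then show ?thesis using ap[OF x(1)] fun_cong[OF g'(2), of x] by (simp add: lift_def)
    next
      case False
      then show ?thesis using lin_mapsD(4)[OF g'(1) False] by (simp add: pull_back_def)
    qed
  qed
  then show "pull_back R B C A g \<in> quot_maps C" using g'(1) by simp
qed

subsection \<open>Minimal cogenerating sets\<close>

lemma quotient_kernel_trivial_iff:
  assumes C: "submodule C R B" and G: "G \<subseteq> quot_maps C"
  shows "{W \<in> carrier (quot_module R B C). \<forall>g\<in>G. g W = \<zero>\<^bsub>E\<^esub>} = {\<zero>\<^bsub>quot_module R B C\<^esub>} \<longleftrightarrow>
         common_kernel (lift C ` G) = C"
proof -
  let ?K = "common_kernel (lift C ` G)"
  have zero: "\<zero>\<^bsub>quot_module R B C\<^esub> = C" by (simp add: quot_module_def)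
  have img: "{W \<in> carrier (quot_module R B C). \<forall>g\<in>G. g W = \<zero>\<^bsub>E\<^esub>} = (\<lambda>x. C +>\<^bsub>B\<^esub> x) ` ?K"
    by (auto simp: B.quot_module_carrier common_kernel_def lift_def)
  have "lift C ` G \<subseteq> perp C" using lift_in_perp[OF C] G by blast
  then have CK: "C \<subseteq> ?K" using subset_perp_iff[of C "lift C ` G"] B.submoduleE(1)[OF C] perp_subset by blast
  have "(\<lambda>x. C +>\<^bsub>B\<^esub> x) ` ?K = {C} \<longleftrightarrow> (\<forall>x\<in>?K. C +>\<^bsub>B\<^esub> x = C)"
    using B.submodule_zero[OF C] CK by blast
  also have "\<dots> \<longleftrightarrow> ?K \<subseteq> C"
    using B.coset_eq_submodule_iff[OF C] common_kernel_subset by blast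
  also have "\<dots> \<longleftrightarrow> ?K = C" using CK by blast
  finally show ?thesis unfolding img zero .
qed

text \<open>
  A minimal cogenerating list has no repetitions, as one of two equal entries could be omitted. So it
  is an enumeration of a set of maps, and omitting an entry is omitting an element of this set.
\<close>

theorem minimal_cogenerating_set_iff:
  assumes C: "submodule C R B"
  shows "minimal_cogenerating_set R E (quot_module R B C) gs \<longleftrightarrow>
    set gs \<subseteq> quot_maps C \<and> distinct (map (lift C) gs) \<and>
    minimal_generating_set Rhat D (perp C) (set (map (lift C) gs))"
proof (cases "set gs \<subseteq> quot_maps C")
  case False
  then show ?thesis by (auto simp: minimal_cogenerating_set_def cogenerating_set_def)
next
  case gs: True
  let ?others = "\<lambda>j. {gs ! i | i. i < length gs \<and> i \<noteq> j}"
  have all: "(\<forall>i<length gs. (gs ! i) W = \<zero>\<^bsub>E\<^esub>) \<longleftrightarrow> (\<forall>g\<in>set gs. g W = \<zero>\<^bsub>E\<^esub>)" for W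
    by (simp add: all_set_conv_all_nth)
  have oth: "(\<forall>i<length gs. i \<noteq> j \<longrightarrow> (gs ! i) W = \<zero>\<^bsub>E\<^esub>) \<longleftrightarrow> (\<forall>g\<in>?others j. g W = \<zero>\<^bsub>E\<^esub>)" for W j
    by auto
  have osub: "?others j \<subseteq> quot_maps C" for j using gs by auto
  have mc: "minimal_cogenerating_set R E (quot_module R B C) gs \<longleftrightarrow>
      common_kernel (lift C ` set gs) = C \<and> (\<forall>j<length gs. common_kernel (lift C ` ?others j) \<noteq> C)"
    unfolding minimal_cogenerating_set_def cogenerating_set_def all oth
      quotient_kernel_trivial_iff[OF C gs] quotient_kernel_trivial_iff[OF C osub]
    using gs by blast
  have lin: "lift C ` set gs \<subseteq> lin_maps R B E" using gs lift_in_perp[OF C] perp_subset by blast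
  have inj: "inj_on (lift C) (set gs)" by (rule inj_on_subset[OF inj_on_lift gs])
  have others: "lift C ` ?others j = lift C ` set gs - {lift C (gs ! j)}"
    if "distinct gs" "j < length gs" for j
  proof -
    have "?others j = set gs - {gs ! j}"
      using that by (auto simp: in_set_conv_nth nth_eq_iff_index_eq)
    then show ?thesis using inj that(2) by (simp add: inj_on_image_set_diff[OF inj])
  qed
  have dist: "distinct gs" if "common_kernel (lift C ` set gs) = C"
    and min: "\<forall>j<length gs. common_kernel (lift C ` ?others j) \<noteq> C"
  proof (rule ccontr)
    assume "\<not> distinct gs"
    then obtain i j where ij: "i < length gs" "j < length gs" "i \<noteq> j" "gs ! i = gs ! j"
      by (auto simp: distinct_conv_nth)
    have "?others j = set gs"
    proof
      show "set gs \<subseteq> ?others j"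
      proof
        fix g assume "g \<in> set gs"
        then obtain k where k: "k < length gs" "g = gs ! k" by (auto simp: in_set_conv_nth)
        show "g \<in> ?others j"
        proof (cases "k = j")
          case True
          then show ?thesis using k ij by (intro CollectI exI[of _ i]) simp
        next
          case False
          then show ?thesis using k by blast
        qed
      qed
    qed auto
    then show False using min ij(2) that(1) by auto
  qed
  have "(\<forall>j<length gs. common_kernel (lift C ` ?others j) \<noteq> C) \<longleftrightarrow>
      (\<forall>f\<in>lift C ` set gs. common_kernel (lift C ` set gs - {f}) \<noteq> C)" if "distinct gs"
    using others[OF that] by (simp add: all_set_conv_all_nth)
  then show ?thesis
    unfolding mc minimal_generating_set_perp_iff[OF C] distinct_map set_map
    using gs lin inj dist by blast
qed

section \<open>Basically empty and basically full submodules\<close>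

text \<open>
  From sets to lists, \<open>S\<close> is enumerated by maps on \<open>B/A\<close> and the rest \<open>T - S\<close> by maps on \<open>B/C\<close>;
  the pull-backs of the former together with the latter then enumerate \<open>T\<close>.
\<close>

lemma extension_iff:
  assumes A: "submodule A R B" and C: "submodule C R B" and CA: "C \<subseteq> A"
  shows "(\<exists>gs hs. minimal_cogenerating_set R E (quot_module R B A) gs \<and>
            minimal_cogenerating_set R E (quot_module R B C) (map (pull_back R B C A) gs @ hs)) \<longleftrightarrow>
         (\<exists>S T. minimal_generating_set Rhat D (perp A) S \<and>
            minimal_generating_set Rhat D (perp C) T \<and> S \<subseteq> T)"
    (is "?L \<longleftrightarrow> ?K")
proof
  have pb: "map (lift C) (map (pull_back R B C A) gs) = map (lift A) gs" if "set gs \<subseteq> quot_maps A" for gs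
    using pull_back_lift(2)[OF C A CA] that by auto
  {
    assume ?L
    then obtain gs hs where gs: "minimal_cogenerating_set R E (quot_module R B A) gs"
      and hs: "minimal_cogenerating_set R E (quot_module R B C) (map (pull_back R B C A) gs @ hs)" by blast
    let ?T = "set (map (lift C) (map (pull_back R B C A) gs @ hs))"
    have gA: "set gs \<subseteq> quot_maps A" and S: "minimal_generating_set Rhat D (perp A) (set (map (lift A) gs))"
      using gs minimal_cogenerating_set_iff[OF A] by blast+
    have T: "minimal_generating_set Rhat D (perp C) ?T"
      using hs minimal_cogenerating_set_iff[OF C] by blast
    have "set (map (lift A) gs) \<subseteq> ?T" unfolding map_append set_append pb[OF gA] by blast
    then show ?K using S T by blast
  }
  assume ?K
  then obtain S T where S: "minimal_generating_set Rhat D (perp A) S"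
    and T: "minimal_generating_set Rhat D (perp C) T" and ST: "S \<subseteq> T" by blast
  have list: "\<exists>gs. set gs \<subseteq> quot_maps C' \<and> distinct (map (lift C') gs) \<and> set (map (lift C') gs) = U"
    if U: "finite U" "U \<subseteq> lift C' ` quot_maps C'" for C' U
  proof -
    obtain G where G: "G \<subseteq> quot_maps C'" "finite G" "U = lift C' ` G"
      using finite_subset_image[OF U] by blast
    obtain gs where "set gs = G" "distinct gs" using finite_distinct_list[OF G(2)] by blast
    then show ?thesis
      using G inj_on_subset[OF inj_on_lift G(1)] by (intro exI[of _ gs]) (simp add: distinct_map)
  qed
  have fin: "finite S" "finite (T - S)"
    using minimal_generating_set_finite[OF A S] minimal_generating_set_finite[OF C T] by simp_all
  have "S \<subseteq> lift A ` quot_maps A" "T - S \<subseteq> lift C ` quot_maps C"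
    unfolding lift_image[OF A] lift_image[OF C]
    using S T unfolding minimal_generating_set_def by blast+
  then obtain gs hs where gs: "set gs \<subseteq> quot_maps A" "distinct (map (lift A) gs)" "set (map (lift A) gs) = S"
    and hs: "set hs \<subseteq> quot_maps C" "distinct (map (lift C) hs)" "set (map (lift C) hs) = T - S"
    using list[OF fin(1)] list[OF fin(2)] by blast
  have lift_list: "map (lift C) (map (pull_back R B C A) gs @ hs) = map (lift A) gs @ map (lift C) hs"
    unfolding map_append pb[OF gs(1)] ..
  have "minimal_cogenerating_set R E (quot_module R B A) gs"
    unfolding minimal_cogenerating_set_iff[OF A] using gs S by simp
  moreover have "minimal_cogenerating_set R E (quot_module R B C) (map (pull_back R B C A) gs @ hs)"
    unfolding minimal_cogenerating_set_iff[OF C] lift_list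
  proof (intro conjI)
    show "set (map (pull_back R B C A) gs @ hs) \<subseteq> quot_maps C"
      using gs(1) hs(1) pull_back_lift(1)[OF C A CA] by auto
    show "distinct (map (lift A) gs @ map (lift C) hs)"
      unfolding distinct_append gs(3) hs(3) using gs(2) hs(2) by blast
    show "minimal_generating_set Rhat D (perp C) (set (map (lift A) gs @ map (lift C) hs))"
      unfolding set_append gs(3) hs(3) using T ST by (simp add: Un_absorb1)
  qed
  ultimately show ?L by blast
qed

text \<open>
  The proper submodules \<open>C\<close> of \<open>A\<close> correspond to the finitely generated modules \<open>N\<close> properly
  containing \<open>perp A\<close>, through \<open>N = perp C\<close> and \<open>C = common_kernel N\<close>.
\<close>

lemma basically_empty_iff_basically_full_perp:
  assumes A: "submodule A R B"
  shows "basically_empty R E B A \<longleftrightarrow> basically_full Rhat D (perp A)"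
proof -
  define ext where "ext N \<longleftrightarrow> (\<exists>S T. minimal_generating_set Rhat D (perp A) S \<and>
    minimal_generating_set Rhat D N T \<and> S \<subseteq> T)" for N
  have ext: "(\<exists>gs hs. minimal_cogenerating_set R E (quot_module R B A) gs \<and>
      minimal_cogenerating_set R E (quot_module R B C) (map (pull_back R B C A) gs @ hs)) \<longleftrightarrow> ext (perp C)"
    if "submodule C R B" "C \<subset> A" for C
    unfolding ext_def by (rule extension_iff[OF A that(1)]) (use that(2) in blast)
  have "basically_empty R E B A \<longleftrightarrow> (\<forall>C. submodule C R B \<and> C \<subset> A \<longrightarrow> \<not> ext (perp C))"
    unfolding basically_empty_def by (intro all_cong1 imp_cong refl) (simp only: ext simp_thms)
  also have "\<dots> \<longleftrightarrow> (\<forall>N. submodule N Rhat D \<and> finitely_generated Rhat D N \<and> perp A \<subset> N \<longrightarrow> \<not> ext N)"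
  proof (intro iffI allI impI)
    fix N assume hyp: "\<forall>C. submodule C R B \<and> C \<subset> A \<longrightarrow> \<not> ext (perp C)"
      and N: "submodule N Rhat D \<and> finitely_generated Rhat D N \<and> perp A \<subset> N"
    have NB: "N \<subseteq> lin_maps R B E"
      using subgroup.subset[OF submodule.axioms(1)[OF conjunct1[OF N]]] by (simp add: dual_simps)
    have NC: "perp (common_kernel N) = N" using finitely_generated_is_perp N by blast
    have "common_kernel N \<subseteq> A"
      using common_kernel_antimono[of "perp A" N] common_kernel_perp[OF A] N by blast
    moreover have "common_kernel N \<noteq> A" using NC N by blast
    ultimately have "\<not> ext (perp (common_kernel N))"
      using hyp submodule_common_kernel[OF NB] by blast
    then show "\<not> ext N" unfolding NC .
  next
    fix C assume hyp: "\<forall>N. submodule N Rhat D \<and> finitely_generated Rhat D N \<and> perp A \<subset> N \<longrightarrow> \<not> ext N"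
      and C': "submodule C R B \<and> C \<subset> A"
    have C: "submodule C R B" and CA: "C \<subset> A" using C' by simp_all
    have "perp A \<noteq> perp C"
    proof
      assume "perp A = perp C"
      then have "common_kernel (perp A) = common_kernel (perp C)" by (rule arg_cong)
      then show False unfolding common_kernel_perp[OF A] common_kernel_perp[OF C] using CA by simp
    qed
    moreover have "perp A \<subseteq> perp C" by (rule perp_antimono) (use CA in simp)
    ultimately have "perp A \<subset> perp C" by simp
    then show "\<not> ext (perp C)"
      using hyp submodule_perp[OF B.submoduleE(1)[OF C]] finitely_generated_perp[OF C] by simp
  qed
  also have "\<dots> \<longleftrightarrow> basically_full Rhat D (perp A)"
    unfolding basically_full_def ext_def
    using submodule_perp[OF B.submoduleE(1)[OF A]] finitely_generated_perp[OF A] by simp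
  finally show ?thesis .
qed

end

theorem lemma5p12:
  fixes R :: "('a, 'r) ring_scheme" and m :: "'a set"
    and E :: "('a, 'e, 'z) module_scheme"
    and B :: "('a, 'b, 'y) module_scheme" and A :: "'b set"
  assumes "noetherian_ring R" and "local_ring R m"
    and "injective_hull TYPE('a) R (quot_module R (regular_module R) m) E"
    and "artinian_module R B" and "submodule A R B"
    and "artinian_module R (B\<lparr>carrier := A\<rparr>)"
  shows "basically_empty R E B A \<longleftrightarrow>
         basically_full (completion R m) (dual_module R m E B) (dual_of_quotient R m E B A)"
proof -
  interpret artinian_dual R m E B
    by (intro artinian_dual.intro noetherian_local_ring_hull.intro noetherian_local_ring.intro
        noetherian_local_ring_hull_axioms.intro artinian_over_local.intro
        artinian_over_local_axioms.intro assms)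
  show ?thesis
    using basically_empty_iff_basically_full_perp[OF assms(5)] dual_of_quotient_eq[OF assms(5)] by simp
qed

end
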